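(* For every $\mu\in\mathcal{G}_1$ we have $\chi_\mu=\theta_\mu\circ\Phi$, where $\chi_\mu:\mathcal{Y}^{(1)}\to\mathbb{C}$, $\theta_\mu:\mathrm{Sym}\to\mathbb{C}$ and $\Phi:\mathcal{Y}^{(1)}\to\mathrm{Sym}$ are the unital algebra homomorphisms determined by: $\chi_\mu(Y_n)=\alpha_n$ for $n\ge2$, where $R_\mu(z)=z+\sum_{n=2}^\infty\alpha_nz^n$ is the $R$-transform of $\mu$; $\theta_\mu(h_n)=(-1)^n\beta_n$ for $n\ge1$, where $S_\mu(z)=1+\sum_{n=1}^\infty\beta_nz^n$ is the $S$-transform of $\mu$; and $\Phi(Y_n)=y_n$ for $n\ge2$, where $y_n=\sum_{\pi=\{A_1,\dots,A_q\}\in NC(n-1)}e_{|A_1|}\cdots e_{|A_q|}\in\mathrm{Sym}$.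
   Context: $\mathcal{G}_1$ is the set of linear functionals $\mu:\mathbb{C}[X]\to\mathbb{C}$ with $\mu(1)=1$ and $\mu(X)=1$. $NC(n)$ is the set of non-crossing partitions of $\{1,\dots,n\}$. The $R$-transform $R_\mu(z)=\sum_{n\ge1}\alpha_nz^n$ is the unique series with $\mu(X^n)=\sum_{\pi\in NC(n)}\prod_{B\text{ block of }\pi}\alpha_{|B|}$ for all $n\ge1$ (so $\alpha_1=1$ for $\mu\in\mathcal{G}_1$). The $S$-transform is $S_\mu(z):=\frac{1+z}{z}M_\mu^{\langle-1\rangle}(z)$, where $M_\mu(z)=z+\sum_{n\ge2}\mu(X^n)z^n$ and $\langle-1\rangle$ denotes inverse under composition; it has constant term $1$. $\mathcal{Y}^{(1)}=\mathbb{C}[Y_n\mid n\ge2]$ is a commutative polynomial algebra. $\mathrm{Sym}$ is the algebra of symmetric functions over $\mathbb{C}$; $e_n$ and $h_n$ ($n\ge1$) denote the elementary, respectively complete homogeneous, symmetric functions; each of the two sequences generates $\mathrm{Sym}$ as a commutative polynomial algebra. *)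

theory Defs
  imports
    "HOL-Computational_Algebra.Computational_Algebra"
    "HOL-Library.Poly_Mapping"
    "HOL-Library.Multiset"
    "HOL-Library.Disjoint_Sets"
begin

definition noncrossing :: "nat set set \<Rightarrow> bool" where
  "noncrossing \<pi> \<longleftrightarrow>
     \<not> (\<exists>A\<in>\<pi>. \<exists>B\<in>\<pi>. A \<noteq> B \<and>
          (\<exists>i j k l. i < j \<and> j < k \<and> k < l \<and> i \<in> A \<and> k \<in> A \<and> j \<in> B \<and> l \<in> B))"

definition NC :: "nat \<Rightarrow> nat set set set" where
  "NC n = {\<pi>. partition_on {1..n} \<pi> \<and> noncrossing \<pi>}"

definition G1 :: "(complex poly \<Rightarrow> complex) set" where
  "G1 = {\<mu>. Vector_Spaces.linear smult (*) \<mu> \<and> \<mu> 1 = 1 \<and> \<mu> (monom 1 1) = 1}"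

definition R_transform :: "(complex poly \<Rightarrow> complex) \<Rightarrow> complex fps" where
  "R_transform \<mu> =
     (THE R. fps_nth R 0 = 0 \<and>
        (\<forall>n\<ge>1. \<mu> (monom 1 n) = (\<Sum>\<pi>\<in>NC n. \<Prod>B\<in>\<pi>. fps_nth R (card B))))"

definition M_series :: "(complex poly \<Rightarrow> complex) \<Rightarrow> complex fps" where
  "M_series \<mu> = fps_X + Abs_fps (\<lambda>n. if n \<ge> 2 then \<mu> (monom 1 n) else 0)"

text \<open>\<open>fps_inv\<close> is the inverse under composition. Its constant term is \<open>0\<close>, so the
  division by \<open>fps_X\<close> is exact.\<close>

definition S_transform :: "(complex poly \<Rightarrow> complex) \<Rightarrow> complex fps" where
  "S_transform \<mu> = (1 + fps_X) * fps_inv (M_series \<mu>) / fps_X"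

definition alg_hom ::
  "(complex \<Rightarrow> 'a::ring_1 \<Rightarrow> 'a) \<Rightarrow> (complex \<Rightarrow> 'b::ring_1 \<Rightarrow> 'b) \<Rightarrow> ('a \<Rightarrow> 'b) \<Rightarrow> bool" where
  "alg_hom s1 s2 f \<longleftrightarrow>
     Vector_Spaces.linear s1 s2 f \<and> f 1 = 1 \<and> (\<forall>x y. f (x * y) = f x * f y)"

typedef yindex = "{n::nat. 2 \<le> n}"
  morphisms nat_of_yindex yindex
  by blast

text \<open>
  A monomial in commuting variables is encoded as the finite multiset of (the indices of)
  its factors. Multisets under addition form the free commutative monoid, so the convolution
  product of \<open>Poly_Mapping\<close> is the product of polynomials.
\<close>

type_synonym Y1 = "yindex multiset \<Rightarrow>\<^sub>0 complex"

definition Y1_scale :: "complex \<Rightarrow> Y1 \<Rightarrow> Y1" where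
  "Y1_scale c p = Poly_Mapping.map ((*) c) p"

text \<open>\<open>Y n\<close> is only meaningful for \<open>n \<ge> 2\<close>.\<close>

definition Y :: "nat \<Rightarrow> Y1" where
  "Y n = Poly_Mapping.single {#yindex n#} 1"

lemma lookup_Y1_scale: "Poly_Mapping.lookup (Y1_scale c p) M = c * Poly_Mapping.lookup p M"
  by (simp add: Y1_scale_def map.rep_eq when_def)

lemma vector_space_Y1: "vector_space Y1_scale"
  by unfold_locales
    (auto intro!: poly_mapping_eqI simp: lookup_Y1_scale lookup_add algebra_simps)

text \<open>
  Formal power series of bounded degree in the variables \<open>x\<^sub>0, x\<^sub>1, x\<^sub>2, \<dots>\<close> whose coefficients are
  invariant under permuting the variables. A series is given by its coefficient function; the
  monomial \<open>x\<^sub>i x\<^sub>j \<dots> x\<^sub>k\<close> is the multiset \<open>{#i, j, \<dots>, k#}\<close>, its degree is the size.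
\<close>

definition is_sym :: "(nat multiset \<Rightarrow> complex) \<Rightarrow> bool" where
  "is_sym f \<longleftrightarrow>
     (\<exists>d. \<forall>M. f M \<noteq> 0 \<longrightarrow> size M \<le> d) \<and>
     (\<forall>\<sigma> M. bij \<sigma> \<longrightarrow> f (image_mset \<sigma> M) = f M)"

typedef sym = "{f. is_sym f}"
  morphisms sym_coeff Abs_sym
  by (rule exI[of _ "\<lambda>_. 0"]) (simp add: is_sym_def)

setup_lifting type_definition_sym

definition conv :: "(nat multiset \<Rightarrow> complex) \<Rightarrow> (nat multiset \<Rightarrow> complex) \<Rightarrow> nat multiset \<Rightarrow> complex" where
  "conv f g M = (\<Sum>A | A \<subseteq># M. f A * g (M - A))"

lemma finite_submsets: "finite {A. A \<subseteq># (M :: 'a multiset)}"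
proof (induction M)
  case (add x M)
  have "{A. A \<subseteq># add_mset x M} \<subseteq> {A. A \<subseteq># M} \<union> add_mset x ` {A. A \<subseteq># M}"
  proof
    fix A assume "A \<in> {A. A \<subseteq># add_mset x M}"
    then have A: "A \<subseteq># add_mset x M" by simp
    show "A \<in> {A. A \<subseteq># M} \<union> add_mset x ` {A. A \<subseteq># M}"
    proof (cases "x \<in># A")
      case True
      then obtain B where B: "A = add_mset x B" by (metis insert_DiffM)
      with A show ?thesis by auto
    next
      case False
      with A have "A \<subseteq># M"
        by (metis Diff_eq_empty_iff_mset add_mset_remove_trivial_eq add_mset_diff_bothsides
              diff_single_trivial subset_eq_diff_conv add_mset_add_single)
      then show ?thesis by simp
    qed
  qed
  with add.IH show ?case by (meson finite_UnI finite_imageI finite_subset)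
qed simp

lemma conv_commute: "conv f g = conv g f"
proof
  fix M
  show "conv f g M = conv g f M"
    unfolding conv_def
    by (rule sum.reindex_bij_witness[of _ "\<lambda>A. M - A" "\<lambda>A. M - A"])
      (auto simp: mult.commute subset_mset.diff_diff_right subset_mset.diff_add_assoc2)
qed

lemma conv_assoc: "conv (conv f g) h = conv f (conv g h)"
proof
  fix M
  have 1: "A - B \<subseteq># M - B" "B \<subseteq># M" if "A \<subseteq># M" "B \<subseteq># A" for A B :: "nat multiset"
    using that by (auto simp: subseteq_mset_def intro: diff_le_mono le_trans)
  have 2: "M - B - (A - B) = M - A" if "A \<subseteq># M" "B \<subseteq># A" for A B :: "nat multiset"
    using that(2) by (simp add: subset_mset.add_diff_inverse)
  have 3: "B + C \<subseteq># M" if "B \<subseteq># M" "C \<subseteq># M - B" for B C :: "nat multiset"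
    using that by (simp add: subset_mset.le_diff_conv2 add.commute)
  have "conv (conv f g) h M =
      (\<Sum>(A, B)\<in>(SIGMA A:{A. A \<subseteq># M}. {B. B \<subseteq># A}). f B * g (A - B) * h (M - A))"
    unfolding conv_def sum_distrib_right by (rule sum.Sigma) (auto simp: finite_submsets)
  also have "\<dots> =
      (\<Sum>(B, C)\<in>(SIGMA B:{B. B \<subseteq># M}. {C. C \<subseteq># M - B}). f B * (g C * h (M - B - C)))"
    by (rule sum.reindex_bij_witness[of _ "\<lambda>(B, C). (B + C, B)" "\<lambda>(A, B). (B, A - B)"])
      (auto simp: mult.assoc 1 2 3 simp del: diff_diff_add_mset)
  also have "\<dots> = conv f (conv g h) M"
    unfolding conv_def sum_distrib_left
    by (rule sum.Sigma[symmetric]) (auto simp: finite_submsets)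
  finally show "conv (conv f g) h M = conv f (conv g h) M" .
qed

lemma is_sym_conv:
  assumes "is_sym f" "is_sym g"
  shows "is_sym (conv f g)"
  unfolding is_sym_def
proof (intro conjI allI impI)
  obtain d d' where d: "\<And>M. f M \<noteq> 0 \<Longrightarrow> size M \<le> d" "\<And>M. g M \<noteq> 0 \<Longrightarrow> size M \<le> d'"
    using assms unfolding is_sym_def by blast
  show "\<exists>d. \<forall>M. conv f g M \<noteq> 0 \<longrightarrow> size M \<le> d"
  proof (intro exI allI impI)
    fix M assume "conv f g M \<noteq> 0"
    then obtain A where A: "A \<subseteq># M" "f A * g (M - A) \<noteq> 0"
      unfolding conv_def by (metis (mono_tags, lifting) mem_Collect_eq sum.neutral)
    then have "size A \<le> d" "size (M - A) \<le> d'" using d by auto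
    moreover have "size M = size A + size (M - A)"
      using A(1) by (metis size_union subset_mset.add_diff_inverse)
    ultimately show "size M \<le> d + d'" by linarith
  qed
next
  fix \<sigma> :: "nat \<Rightarrow> nat" and M assume \<sigma>: "bij \<sigma>"
  have inv: "image_mset (inv \<sigma>) (image_mset \<sigma> A) = A" "image_mset \<sigma> (image_mset (inv \<sigma>) A) = A" for A
    using \<sigma> by (simp_all add: multiset.map_comp o_def bij_is_inj bij_is_surj surj_f_inv_f)
  have sym: "f (image_mset \<sigma> A) = f A" "g (image_mset \<sigma> A) = g A" for A
    using assms \<sigma> unfolding is_sym_def by auto
  show "conv f g (image_mset \<sigma> M) = conv f g M"
    unfolding conv_def
    by (rule sum.reindex_bij_witness[of _ "image_mset \<sigma>" "image_mset (inv \<sigma>)"])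
      (auto simp: inv sym image_mset_Diff[symmetric] image_mset_subseteq_mono
        dest: image_mset_subseteq_mono[of _ _ "inv \<sigma>"],
       metis inv(2) sym image_mset_Diff image_mset_subseteq_mono inv(1))
qed

lemma conv_one: "conv (\<lambda>M. if M = {#} then 1 else 0) f = f"
proof
  fix M
  have "conv (\<lambda>M. if M = {#} then 1 else 0) f M =
      (\<Sum>A | A \<subseteq># M. if A = {#} then f (M - A) else 0)"
    unfolding conv_def by (rule sum.cong) auto
  also have "\<dots> = f M" by (simp add: sum.delta finite_submsets)
  finally show "conv (\<lambda>M. if M = {#} then 1 else 0) f M = f M" .
qed

lemma is_sym_add:
  assumes "is_sym f" "is_sym g"
  shows "is_sym (\<lambda>M. f M + g M)"
proof -
  obtain d d' where d: "\<And>M. f M \<noteq> 0 \<Longrightarrow> size M \<le> d" "\<And>M. g M \<noteq> 0 \<Longrightarrow> size M \<le> d'"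
    using assms unfolding is_sym_def by blast
  have "size M \<le> max d d'" if "f M + g M \<noteq> 0" for M
    using d[of M] that by (cases "f M = 0") auto
  then show ?thesis using assms unfolding is_sym_def by (metis (no_types, lifting))
qed

lemma is_sym_scale: "is_sym f \<Longrightarrow> is_sym (\<lambda>M. c * f M)"
  unfolding is_sym_def by (metis mult_zero_right)

instantiation sym :: comm_ring_1
begin

lift_definition zero_sym :: sym is "\<lambda>_. 0" by (simp add: is_sym_def)
lift_definition one_sym :: sym is "\<lambda>M. if M = {#} then 1 else 0" by (auto simp: is_sym_def)
lift_definition plus_sym :: "sym \<Rightarrow> sym \<Rightarrow> sym" is "\<lambda>f g M. f M + g M" by (rule is_sym_add)
lift_definition uminus_sym :: "sym \<Rightarrow> sym" is "\<lambda>f M. - f M" by (simp add: is_sym_def)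
lift_definition minus_sym :: "sym \<Rightarrow> sym \<Rightarrow> sym" is "\<lambda>f g M. f M - g M"
  using is_sym_add[OF _ is_sym_scale[of _ "- 1"]] by simp
lift_definition times_sym :: "sym \<Rightarrow> sym \<Rightarrow> sym" is conv by (rule is_sym_conv)

instance
proof
  fix a b c :: sym
  show "a * b * c = a * (b * c)" by transfer (rule conv_assoc)
  show "a * b = b * a" by transfer (rule conv_commute)
  show "1 * a = a" by transfer (rule conv_one)
  show "a + b + c = a + (b + c)" by transfer (simp add: add.assoc)
  show "a + b = b + a" by transfer (simp add: add.commute)
  show "0 + a = a" by transfer simp
  show "- a + a = 0" by transfer simp
  show "a - b = a + - b" by transfer simp
  show "(a + b) * c = a * c + b * c"
    by transfer (simp add: conv_def fun_eq_iff distrib_right sum.distrib)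
  show "(0::sym) \<noteq> 1" by transfer (auto simp: fun_eq_iff)
qed

end

lift_definition sym_scale :: "complex \<Rightarrow> sym \<Rightarrow> sym" is "\<lambda>c f M. c * f M"
  by (rule is_sym_scale)

lemma vector_space_sym: "vector_space sym_scale"
  by unfold_locales (transfer; simp add: algebra_simps)+

lemma sym_scale_mult: "sym_scale c f * g = sym_scale c (f * g)"
  by transfer (simp add: conv_def fun_eq_iff sum_distrib_left mult.assoc)

text \<open>\<open>elem_sym n\<close> is the sum of all squarefree monomials of degree \<open>n\<close>, and \<open>complete_sym n\<close> the sum
  of all monomials of degree \<open>n\<close>.\<close>

lift_definition elem_sym :: "nat \<Rightarrow> sym" is
  "\<lambda>n M. if size M = n \<and> (\<forall>i. count M i \<le> 1) then 1 else 0"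
proof -
  fix n
  have "(\<forall>i. count (image_mset \<sigma> M) i \<le> 1) \<longleftrightarrow> (\<forall>i. count M i \<le> 1)"
    if "bij \<sigma>" for \<sigma> :: "nat \<Rightarrow> nat" and M
  proof -
    have "count (image_mset \<sigma> M) (\<sigma> i) = count M i" for i
      
    proof -
      have "\<sigma> -` {\<sigma> i} \<inter> set_mset M = {i} \<inter> set_mset M"
        using that by (auto dest: bij_is_inj injD)
      then show ?thesis by (cases "i \<in># M") (auto simp: count_image_mset not_in_iff)
    qed
    moreover have "\<exists>j. i = \<sigma> j" for i using that by (metis bij_pointE)
    ultimately show ?thesis by metis
  qed
  then show "is_sym (\<lambda>M. if size M = n \<and> (\<forall>i. count M i \<le> 1) then 1 else 0)"
    by (auto simp: is_sym_def)
qed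

lift_definition complete_sym :: "nat \<Rightarrow> sym" is "\<lambda>n M. if size M = n then 1 else 0"
  by (auto simp: is_sym_def)

definition is_chi :: "(complex poly \<Rightarrow> complex) \<Rightarrow> (Y1 \<Rightarrow> complex) \<Rightarrow> bool" where
  "is_chi \<mu> \<chi> \<longleftrightarrow>
     alg_hom Y1_scale (*) \<chi> \<and> (\<forall>n\<ge>2. \<chi> (Y n) = fps_nth (R_transform \<mu>) n)"

definition is_theta :: "(complex poly \<Rightarrow> complex) \<Rightarrow> (sym \<Rightarrow> complex) \<Rightarrow> bool" where
  "is_theta \<mu> \<theta> \<longleftrightarrow>
     alg_hom sym_scale (*) \<theta> \<and>
     (\<forall>n\<ge>1. \<theta> (complete_sym n) = (- 1) ^ n * fps_nth (S_transform \<mu>) n)"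

definition y_sym :: "nat \<Rightarrow> sym" where
  "y_sym n = (\<Sum>\<pi>\<in>NC (n - 1). \<Prod>A\<in>\<pi>. elem_sym (card A))"

definition is_Phi :: "(Y1 \<Rightarrow> sym) \<Rightarrow> bool" where
  "is_Phi \<Phi> \<longleftrightarrow> alg_hom Y1_scale sym_scale \<Phi> \<and> (\<forall>n\<ge>2. \<Phi> (Y n) = y_sym n)"

definition chi :: "(complex poly \<Rightarrow> complex) \<Rightarrow> Y1 \<Rightarrow> complex" where
  "chi \<mu> = (THE \<chi>. is_chi \<mu> \<chi>)"

definition theta :: "(complex poly \<Rightarrow> complex) \<Rightarrow> sym \<Rightarrow> complex" where
  "theta \<mu> = (THE \<theta>. is_theta \<mu> \<theta>)"

definition Phi :: "Y1 \<Rightarrow> sym" where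
  "Phi = (THE \<Phi>. is_Phi \<Phi>)"

end

theory Submission
  imports Defs
begin

text \<open>
  Everything reduces to one identity of power series. A homomorphism on \<open>\<complex>[Y\<^sub>2, Y\<^sub>3, \<dots>]\<close> is given by
  its values at the \<open>Y\<^sub>n\<close>, so the claim is that \<open>\<theta>\<^sub>\<mu>(y\<^sub>n) = \<alpha>\<^sub>n\<close> for \<open>n \<ge> 2\<close>.

  Since \<open>\<Sum> e\<^sub>n z\<^sup>n\<close> and \<open>\<Sum> h\<^sub>n (-z)\<^sup>n\<close> are inverse to each other, the prescription for the \<open>h\<^sub>n\<close> says
  that \<open>\<theta>\<^sub>\<mu>(e\<^sub>n)\<close> is the coefficient of \<open>z\<^sup>n\<close> in \<open>1/S\<^sub>\<mu>(z)\<close> (\<open>hom_complete_iff_hom_elem\<close>). So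
  \<open>\<theta>\<^sub>\<mu>(y\<^sub>n)\<close> is the moment of order \<open>n - 1\<close> for the free cumulants with generating function \<open>1/S\<^sub>\<mu>\<close>.
  The moments \<open>N\<close> and the cumulants \<open>K\<close>, both with constant term \<open>1\<close>, satisfy \<open>N(z) = K(z N(z))\<close>
  (\<open>nc_moments_functional_equation\<close>), which says that \<open>z N(z)\<close> is the compositional inverse of
  \<open>z/K(z)\<close>. For \<open>K = 1/S\<^sub>\<mu>\<close> this is the inverse of \<open>z S\<^sub>\<mu>(z)\<close>. But \<open>R\<^sub>\<mu>\<close> is the inverse of
  \<open>z S\<^sub>\<mu>(z)\<close> too (\<open>R_transform_eq_fps_inv\<close>), by the same functional equation for \<open>\<mu>\<close>. Hence
  \<open>R\<^sub>\<mu>(z) = z N(z)\<close>, and comparing coefficients gives the claim (\<open>R_transform_nth\<close>).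

  The functional equation rests on a decomposition of non-crossing partitions
  (\<open>rooted_sum_rec\<close>), which takes the elements of the block of the smallest point one at a time, so that
  each step cuts an interval into two.

  The remaining task is that \<open>\<theta>\<^sub>\<mu>\<close> exists and is unique. Uniqueness is the generation of the symmetric
  functions by the \<open>e\<^sub>n\<close>, in the form that homomorphisms agreeing at \<open>e\<^sub>1, \<dots>, e\<^sub>d\<close> agree in degree at
  most \<open>d\<close> (\<open>sym_hom_eq_of_elem\<close>). For existence, \<open>\<complex>\<close> is algebraically
  closed, so any values of \<open>e\<^sub>1, \<dots>, e\<^sub>N\<close> are attained at some point with \<open>N\<close>
  coordinates; the evaluations at these points fit together to one homomorphism
  (\<open>sym_hom_with_elem_values\<close>).
\<close>

section \<open>Decomposition of non-crossing partitions\<close>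

text \<open>
  Recursion over non-crossing partitions cuts \<open>{1..n}\<close> into pieces that no longer start at \<open>1\<close>,
  so the underlying set is a parameter here.
\<close>

definition NCP :: "nat set \<Rightarrow> nat set set set" where
  "NCP S = {\<pi>. partition_on S \<pi> \<and> noncrossing \<pi>}"

lemma NC_eq_NCP: "NC n = NCP {1..<Suc n}"
  by (simp add: NC_def NCP_def atLeastLessThanSuc_atLeastAtMost)

lemma finite_NCP: "finite S \<Longrightarrow> finite (NCP S)"
  unfolding NCP_def by (rule finite_subset[OF _ finitely_many_partition_on]) auto

lemma NCP_empty: "NCP {} = {{}}"
  by (auto simp: NCP_def partition_on_empty noncrossing_def)

lemma noncrossingD:
  "noncrossing \<pi> \<Longrightarrow> A \<in> \<pi> \<Longrightarrow> B \<in> \<pi> \<Longrightarrow> A \<noteq> B \<Longrightarrow> i < j \<Longrightarrow> j < k \<Longrightarrow> k < l \<Longrightarrow>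
    i \<in> A \<Longrightarrow> k \<in> A \<Longrightarrow> j \<in> B \<Longrightarrow> l \<in> B \<Longrightarrow> False"
  unfolding noncrossing_def by (erule notE) (intro bexI exI conjI)

lemma noncrossingI:
  "(\<And>A B i j k l. A \<in> \<pi> \<Longrightarrow> B \<in> \<pi> \<Longrightarrow> A \<noteq> B \<Longrightarrow> i < j \<Longrightarrow> j < k \<Longrightarrow> k < l \<Longrightarrow>
    i \<in> A \<Longrightarrow> k \<in> A \<Longrightarrow> j \<in> B \<Longrightarrow> l \<in> B \<Longrightarrow> False) \<Longrightarrow> noncrossing \<pi>"
  unfolding noncrossing_def by blast

lemma noncrossing_subset:
  assumes "noncrossing \<pi>" "\<rho> \<subseteq> \<pi>"
  shows "noncrossing \<rho>"
proof (rule noncrossingI)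
  fix A B i j k l
  assume "A \<in> \<rho>" "B \<in> \<rho>" "A \<noteq> B" "i < j" "j < k" "k < (l::nat)" "i \<in> A" "k \<in> A" "j \<in> B" "l \<in> B"
  then show False
    using noncrossingD[OF assms(1), of A B i j k l] assms(2) by (simp add: subset_iff)
qed

text \<open>
  Removing points from blocks cannot create a crossing. Blocks that become equal cause no
  trouble, since a crossing needs two different blocks.
\<close>

lemma noncrossing_shrink:
  assumes "noncrossing \<pi>" "\<And>D. D \<in> \<pi> \<Longrightarrow> f D \<subseteq> D"
  shows "noncrossing (f ` \<pi>)"
proof (rule noncrossingI)
  fix A B i j k l
  assume "A \<in> f ` \<pi>" "B \<in> f ` \<pi>" "A \<noteq> B" "i < j" "j < k" "k < (l::nat)" "i \<in> A" "k \<in> A" "j \<in> B" "l \<in> B"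
  moreover from this obtain A' B' where "A' \<in> \<pi>" "B' \<in> \<pi>" "A = f A'" "B = f B'" by blast
  ultimately show False
    using noncrossingD[OF assms(1), of A' B' i j k l] assms(2) by blast
qed

lemma noncrossing_strict_mono_image:
  assumes "strict_mono f"
  shows "noncrossing ((`) f ` \<pi>) \<longleftrightarrow> noncrossing \<pi>"
proof
  assume *: "noncrossing ((`) f ` \<pi>)"
  show "noncrossing \<pi>"
  proof (rule noncrossingI)
    fix A B i j k l
    assume "A \<in> \<pi>" "B \<in> \<pi>" "A \<noteq> B" "i < j" "j < k" "k < (l::nat)" "i \<in> A" "k \<in> A" "j \<in> B" "l \<in> B"
    then show False
      using noncrossingD[OF *, of "f ` A" "f ` B" "f i" "f j" "f k" "f l"] assms
      by (simp add: strict_mono_less inj_image_eq_iff strict_mono_imp_inj_on)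
  qed
next
  assume *: "noncrossing \<pi>"
  show "noncrossing ((`) f ` \<pi>)"
  proof (rule noncrossingI)
    fix A B i j k l
    assume "A \<in> (`) f ` \<pi>" "B \<in> (`) f ` \<pi>" "A \<noteq> B" "i < j" "j < k" "k < l"
      "i \<in> A" "k \<in> A" "j \<in> B" "l \<in> B"
    then obtain A' B' i' j' k' l' where "A' \<in> \<pi>" "B' \<in> \<pi>" "A' \<noteq> B'"
      "i' \<in> A'" "k' \<in> A'" "j' \<in> B'" "l' \<in> B'" "f i' < f j'" "f j' < f k'" "f k' < f l'"
      by blast
    then show False
      using noncrossingD[OF *, of A' B' i' j' k' l'] assms by (simp add: strict_mono_less)
  qed
qed

lemma partition_on_image:
  assumes "partition_on A P" "inj_on f A"
  shows "partition_on (f ` A) ((`) f ` P)"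
proof -
  have "(`) f ` P - {{}} = (`) f ` P" using partition_onD3[OF assms(1)] by auto
  with partition_on_inj_image[OF assms] show ?thesis by simp
qed

lemma NCP_image:
  assumes "strict_mono f"
  shows "NCP (f ` S) = (`) ((`) f) ` NCP S"
proof (intro equalityI subsetI)
  have inj: "inj f" using assms by (rule strict_mono_imp_inj_on)
  fix \<pi> assume "\<pi> \<in> (`) ((`) f) ` NCP S"
  then show "\<pi> \<in> NCP (f ` S)"
    using inj by (auto simp: NCP_def noncrossing_strict_mono_image[OF assms]
      intro!: partition_on_image inj_on_subset[OF inj])
next
  have inj: "inj f" using assms by (rule strict_mono_imp_inj_on)
  fix \<pi> assume \<pi>: "\<pi> \<in> NCP (f ` S)"
  define \<rho> where "\<rho> = (`) (inv f) ` \<pi>"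
  have sub: "D \<subseteq> f ` S" if "D \<in> \<pi>" for D
    using \<pi> that by (auto simp: NCP_def partition_on_def)
  have "f ` inv f ` D = D" if "D \<in> \<pi>" for D
    using sub[OF that] by (force simp: image_image inj intro: f_inv_into_f)
  then have eq: "\<pi> = (`) f ` \<rho>" by (simp add: \<rho>_def image_image)
  have "partition_on (inv f ` f ` S) \<rho>"
    unfolding \<rho>_def using \<pi> inj_on_inv_into[of "f ` S" f UNIV]
    by (intro partition_on_image) (auto simp: NCP_def)
  then have "partition_on S \<rho>" by (simp add: image_image inj)
  moreover have "noncrossing \<rho>"
    using \<pi> noncrossing_strict_mono_image[OF assms, of \<rho>] by (simp add: eq[symmetric] NCP_def)
  ultimately show "\<pi> \<in> (`) ((`) f) ` NCP S"
    unfolding eq by (auto simp: NCP_def)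
qed

text \<open>
  The block containing the root \<open>r\<close> is weighted by its own sequence \<open>c\<close>. Removing one element from
  that block then amounts to replacing \<open>c\<close> by its shift, which is what makes a recursion possible
  that peels off the elements of the root block one by one.
\<close>

definition rooted_weight ::
  "(nat \<Rightarrow> 'a::comm_monoid_mult) \<Rightarrow> (nat \<Rightarrow> 'a) \<Rightarrow> nat \<Rightarrow> nat set set \<Rightarrow> 'a" where
  "rooted_weight c \<kappa> r \<pi> = (\<Prod>B\<in>\<pi>. if r \<in> B then c (card B) else \<kappa> (card B))"

definition rooted_sum ::
  "(nat \<Rightarrow> 'a::comm_semiring_1) \<Rightarrow> (nat \<Rightarrow> 'a) \<Rightarrow> nat \<Rightarrow> nat \<Rightarrow> 'a" where
  "rooted_sum c \<kappa> a b = (\<Sum>\<pi>\<in>NCP {a..<b}. rooted_weight c \<kappa> a \<pi>)"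

lemma rooted_sum_shift: "rooted_sum c \<kappa> (a + d) (b + d) = rooted_sum c \<kappa> a b"
proof -
  define f :: "nat \<Rightarrow> nat" where "f = (\<lambda>x. x + d)"
  have mono: "strict_mono f" by (simp add: f_def strict_mono_def)
  have inj: "inj f" by (rule strict_mono_imp_inj_on[OF mono])
  have S: "{a + d..<b + d} = f ` {a..<b}" by (simp add: f_def)
  have inj2: "inj_on ((`) ((`) f)) X" for X
    using inj by (metis inj_image_eq_iff inj_onI)
  have w: "rooted_weight c \<kappa> (a + d) ((`) f ` \<pi>) = rooted_weight c \<kappa> a \<pi>" for \<pi>
  proof -
    have "inj_on ((`) f) \<pi>" using inj by (metis inj_image_eq_iff inj_onI)
    then show ?thesis unfolding rooted_weight_def
      by (subst prod.reindex) (auto simp: f_def card_image intro!: prod.cong)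
  qed
  show ?thesis
    unfolding rooted_sum_def S NCP_image[OF mono]
    by (subst sum.reindex[OF inj2]) (simp add: w)
qed

lemma rooted_weight_same: "rooted_weight \<kappa> \<kappa> r \<pi> = (\<Prod>B\<in>\<pi>. \<kappa> (card B))"
  by (simp add: rooted_weight_def)

text \<open>
  A singleton block crosses nothing, so it can be added and removed freely.
\<close>

lemma NCP_singleton_root:
  assumes "a < b"
  shows "{\<pi> \<in> NCP {a..<b}. {a} \<in> \<pi>} = insert {a} ` NCP {Suc a..<b}"
proof (intro equalityI subsetI)
  fix \<pi> assume "\<pi> \<in> {\<pi> \<in> NCP {a..<b}. {a} \<in> \<pi>}"
  then have p: "partition_on {a..<b} \<pi>" "noncrossing \<pi>" "{a} \<in> \<pi>" by (auto simp: NCP_def)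
  have "a \<notin> X" if "X \<in> \<pi>" "X \<noteq> {a}" for X
    using disjointD[OF partition_onD2[OF p(1)] that(1) p(3) that(2)] by simp
  then have "disjnt {a} (\<Union>(\<pi> - {{a}}))" by (auto simp: disjnt_def)
  from partition_on_insert[OF this] have "partition_on ({a..<b} - {a}) (\<pi> - {{a}})"
    using p(1) p(3) by (simp add: insert_absorb)
  moreover have "{a..<b} - {a} = {Suc a..<b}" by auto
  moreover have "noncrossing (\<pi> - {{a}})" by (rule noncrossing_subset[OF p(2)]) auto
  ultimately have "\<pi> - {{a}} \<in> NCP {Suc a..<b}" by (simp add: NCP_def)
  with p(3) show "\<pi> \<in> insert {a} ` NCP {Suc a..<b}"
    by (intro image_eqI[of _ _ "\<pi> - {{a}}"]) auto
next
  fix \<pi> assume "\<pi> \<in> insert {a} ` NCP {Suc a..<b}"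
  then obtain \<rho> where \<rho>: "\<pi> = insert {a} \<rho>" "partition_on {Suc a..<b} \<rho>" "noncrossing \<rho>"
    by (auto simp: NCP_def)
  have "{a..<b} - {a} = {Suc a..<b}" by auto
  moreover have "disjnt {a} (\<Union>\<rho>)"
    using partition_onD1[OF \<rho>(2), symmetric] by (simp add: disjnt_def)
  ultimately have "partition_on {a..<b} \<pi>"
    using partition_on_insert[of "{a}" \<rho> "{a..<b}"] \<rho>(2) assms by (simp add: \<rho>(1))
  moreover have "noncrossing \<pi>"
    unfolding \<rho>(1)
  proof (rule noncrossingI)
    fix A B i j k l
    assume *: "A \<in> insert {a} \<rho>" "B \<in> insert {a} \<rho>" "A \<noteq> B" "i < j" "j < k" "k < (l::nat)"
      "i \<in> A" "k \<in> A" "j \<in> B" "l \<in> B"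
    then have "A \<in> \<rho>" "B \<in> \<rho>" by auto
    then show False using noncrossingD[OF \<rho>(3), of A B i j k l] * by simp
  qed
  ultimately show "\<pi> \<in> {\<pi> \<in> NCP {a..<b}. {a} \<in> \<pi>}" by (simp add: NCP_def \<rho>(1))
qed

definition attach :: "nat \<Rightarrow> nat \<Rightarrow> nat set \<Rightarrow> nat set" where
  "attach a j D = (if j \<in> D then insert a D else D)"

text \<open>
  In an interval starting at \<open>a\<close> this says that \<open>j\<close> is the second smallest element of the block
  of \<open>a\<close>. No block can then leave the gap between \<open>a\<close> and \<open>j\<close>, because it would cross the block
  of \<open>a\<close>. So the partition is determined by its part inside the gap and by its part on
  \<open>{j..<b}\<close> after removal of \<open>a\<close>, and these two parts are arbitrary non-crossing partitions.
\<close>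

definition first_return :: "nat \<Rightarrow> nat \<Rightarrow> nat set set \<Rightarrow> bool" where
  "first_return a j \<pi> \<longleftrightarrow> (\<exists>B\<in>\<pi>. a \<in> B \<and> j \<in> B \<and> B \<inter> {a<..<j} = {})"

context
  fixes a j b :: nat
  assumes aj: "a < j" and jb: "j < b"
begin

lemma attach_minus: "a \<notin> D \<Longrightarrow> attach a j D - {a} = D"
  by (auto simp: attach_def)

text \<open>
  A block of \<open>\<sigma>\<close> lies strictly between \<open>a\<close> and \<open>j\<close>, where the attached blocks have no elements, so
  it crosses none of them. In a crossing of two attached blocks only the smallest of the four points
  can be \<open>a\<close>. Replacing it by \<open>j\<close>, which lies in the same block, would give a crossing already
  present in \<open>\<tau>\<close>.
\<close>

lemma glue_in_NCP:
  assumes \<sigma>: "\<sigma> \<in> NCP {Suc a..<j}" and \<tau>: "\<tau> \<in> NCP {j..<b}"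
  shows "\<sigma> \<union> attach a j ` \<tau> \<in> NCP {a..<b}" "first_return a j (\<sigma> \<union> attach a j ` \<tau>)"
proof -
  have ps: "partition_on {Suc a..<j} \<sigma>" "noncrossing \<sigma>" and pt: "partition_on {j..<b} \<tau>" "noncrossing \<tau>"
    using assms by (auto simp: NCP_def)
  have s: "D \<subseteq> {Suc a..<j}" if "D \<in> \<sigma>" for D using ps(1) that by (auto simp: partition_on_def)
  have t: "D \<subseteq> {j..<b}" if "D \<in> \<tau>" for D using pt(1) that by (auto simp: partition_on_def)
  have "j \<in> \<Union>\<tau>" using pt(1) jb by (auto simp: partition_on_def)
  then obtain B where B: "B \<in> \<tau>" "j \<in> B" by blast
  have Buniq: "D = B" if "D \<in> \<tau>" "j \<in> D" for D
    using disjointD[OF partition_onD2[OF pt(1)] that(1) B(1)] that(2) B(2) by blast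
  have UB: "\<Union>(attach a j ` \<tau>) = insert a (\<Union>\<tau>)"
    using B by (auto simp: attach_def split: if_splits)
  have at: "x \<in> attach a j D \<Longrightarrow> D \<in> \<tau> \<Longrightarrow> x = a \<and> D = B \<or> (j \<le> x \<and> x < b \<and> x \<in> D)" for x D
    using t[of D] Buniq[of D] by (auto simp: attach_def split: if_splits)
  show "first_return a j (\<sigma> \<union> attach a j ` \<tau>)"
    unfolding first_return_def using B t[of B] aj
    by (intro bexI[of _ "attach a j B"]) (auto simp: attach_def)
  have "partition_on {a..<b} (\<sigma> \<union> attach a j ` \<tau>)"
  proof (rule partition_onI)
    have "\<Union>(\<sigma> \<union> attach a j ` \<tau>) = {Suc a..<j} \<union> insert a {j..<b}"
      using UB partition_onD1[OF ps(1)] partition_onD1[OF pt(1)] by simp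
    then show "\<Union>(\<sigma> \<union> attach a j ` \<tau>) = {a..<b}" using aj jb by auto
    show "{} \<notin> \<sigma> \<union> attach a j ` \<tau>"
      using partition_onD3[OF ps(1)] partition_onD3[OF pt(1)] by (auto simp: attach_def)
    have st: "disjnt p (attach a j D)" if "p \<in> \<sigma>" "D \<in> \<tau>" for p D
      using s[OF that(1)] at[OF _ that(2)] aj by (fastforce simp: disjnt_iff)
    have tt: "disjnt (attach a j D) (attach a j E)" if "D \<in> \<tau>" "E \<in> \<tau>" "D \<noteq> E" for D E
      using disjointD[OF partition_onD2[OF pt(1)] that] at[OF _ that(1)] at[OF _ that(2)] that(3) aj
      by (fastforce simp: disjnt_iff)
    fix p q
    assume *: "p \<in> \<sigma> \<union> attach a j ` \<tau>" "q \<in> \<sigma> \<union> attach a j ` \<tau>" "p \<noteq> q"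
    then consider "p \<in> \<sigma>" "q \<in> \<sigma>" | D where "p \<in> \<sigma>" "D \<in> \<tau>" "q = attach a j D"
      | D where "q \<in> \<sigma>" "D \<in> \<tau>" "p = attach a j D"
      | D E where "D \<in> \<tau>" "p = attach a j D" "E \<in> \<tau>" "q = attach a j E"
      by blast
    then show "disjnt p q"
    proof cases
      case 1
      then show ?thesis using disjointD[OF partition_onD2[OF ps(1)]] *(3) by (simp add: disjnt_def)
    next
      case 2
      then show ?thesis using st by simp
    next
      case 3
      then show ?thesis using st[THEN disjnt_sym] by simp
    next
      case 4
      then show ?thesis using tt[of D E] *(3) by auto
    qed
  qed
  moreover have "noncrossing (\<sigma> \<union> attach a j ` \<tau>)"
  proof (rule noncrossingI)
    fix A D w x y z
    assume *: "A \<in> \<sigma> \<union> attach a j ` \<tau>" "D \<in> \<sigma> \<union> attach a j ` \<tau>" "A \<noteq> D"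
      and lt: "w < x" "x < y" "y < (z::nat)" and el: "w \<in> A" "y \<in> A" "x \<in> D" "z \<in> D"
    consider "A \<in> \<sigma>" "D \<in> \<sigma>" | D' where "A \<in> \<sigma>" "D' \<in> \<tau>" "D = attach a j D'"
      | A' where "A' \<in> \<tau>" "A = attach a j A'" "D \<in> \<sigma>"
      | A' D' where "A' \<in> \<tau>" "A = attach a j A'" "D' \<in> \<tau>" "D = attach a j D'"
      using * by blast
    then show False
    proof cases
      case 1
      then show False using noncrossingD[OF ps(2), of A D w x y z] * lt el by simp
    next
      case 2
      then have "w \<ge> Suc a" "y < j" using s el by fastforce+
      then show False using at[of x D'] 2 el lt by simp
    next
      case 3
      then have "x \<ge> Suc a" "z < j" using s el by fastforce+
      then show False using at[of y A'] 3 el lt by simp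
    next
      case 4
      have ge: "a \<le> w" using at[of w A'] 4 el aj by auto
      have x: "j \<le> x" "x \<in> D'" and y: "y \<in> A'" and z: "z \<in> D'"
        using at[of x D'] at[of y A'] at[of z D'] 4 el lt ge by auto
      have ne: "A' \<noteq> D'" using * 4 by blast
      show False
      proof (cases "w = a")
        case True
        with at[of w A'] 4 el aj have A': "A' = B" by auto
        have "x \<noteq> j" using Buniq[of D'] ne A' x 4 by blast
        then show False
          using noncrossingD[OF pt(2), of A' D' j x y z] 4 ne x y z lt B A' by simp
      next
        case False
        then have "w \<in> A'" using at[of w A'] 4 el by auto
        then show False
          using noncrossingD[OF pt(2), of A' D' w x y z] 4 ne x y z lt by simp
      qed
    qed
  qed
  ultimately show "\<sigma> \<union> attach a j ` \<tau> \<in> NCP {a..<b}" by (simp add: NCP_def)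
qed

lemma split_glue:
  assumes \<sigma>: "\<sigma> \<in> NCP {Suc a..<j}" and \<tau>: "\<tau> \<in> NCP {j..<b}"
  shows "{D \<in> \<sigma> \<union> attach a j ` \<tau>. D \<subseteq> {Suc a..<j}} = \<sigma>"
    and "(\<lambda>D. D - {a}) ` {D \<in> \<sigma> \<union> attach a j ` \<tau>. \<not> D \<subseteq> {Suc a..<j}} = \<tau>"
proof -
  have s: "D \<subseteq> {Suc a..<j}" if "D \<in> \<sigma>" for D using \<sigma> that by (auto simp: partition_on_def NCP_def)
  have t: "D \<subseteq> {j..<b}" "D \<noteq> {}" if "D \<in> \<tau>" for D
    using \<tau> that by (auto simp: partition_on_def NCP_def)
  have t': "\<not> attach a j D \<subseteq> {Suc a..<j}" if D: "D \<in> \<tau>" for D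
  proof -
    obtain x where "x \<in> D" "x \<ge> j" using t(1)[OF D] t(2)[OF D] by fastforce
    then show ?thesis by (auto simp: attach_def)
  qed
  show "{D \<in> \<sigma> \<union> attach a j ` \<tau>. D \<subseteq> {Suc a..<j}} = \<sigma>" using s t' by blast
  have "{D \<in> \<sigma> \<union> attach a j ` \<tau>. \<not> D \<subseteq> {Suc a..<j}} = attach a j ` \<tau>" using s t' by blast
  moreover have "attach a j D - {a} = D" if "D \<in> \<tau>" for D
    using t(1)[OF that] aj by (intro attach_minus) auto
  ultimately show "(\<lambda>D. D - {a}) ` {D \<in> \<sigma> \<union> attach a j ` \<tau>. \<not> D \<subseteq> {Suc a..<j}} = \<tau>"
    by (simp add: image_image)
qed

text \<open>
  A block other than that of \<open>a\<close> which meets the gap stays inside it: with a point \<open>x < j\<close> and a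
  point \<open>y > j\<close> it would cross the block of \<open>a\<close> in \<open>a < x < j < y\<close>.
\<close>

lemma split_in_NCP:
  assumes \<pi>: "\<pi> \<in> NCP {a..<b}" and ret: "first_return a j \<pi>"
  defines "\<sigma> \<equiv> {D \<in> \<pi>. D \<subseteq> {Suc a..<j}}"
    and "\<tau> \<equiv> (\<lambda>D. D - {a}) ` {D \<in> \<pi>. \<not> D \<subseteq> {Suc a..<j}}"
  shows "\<sigma> \<in> NCP {Suc a..<j}" "\<tau> \<in> NCP {j..<b}" "\<sigma> \<union> attach a j ` \<tau> = \<pi>"
proof -
  have p: "partition_on {a..<b} \<pi>" "noncrossing \<pi>" using \<pi> by (auto simp: NCP_def)
  obtain B where B: "B \<in> \<pi>" "a \<in> B" "j \<in> B" "B \<inter> {a<..<j} = {}"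
    using ret unfolding first_return_def by blast
  have sub: "D \<subseteq> {a..<b}" if "D \<in> \<pi>" for D using p(1) that by (auto simp: partition_on_def)
  have disj: "D \<inter> B = {}" if "D \<in> \<pi>" "D \<noteq> B" for D
    using disjointD[OF partition_onD2[OF p(1)] that(1) B(1) that(2)] .
  have upper: "D \<subseteq> {j..<b}" if D: "D \<in> \<pi>" "D \<noteq> B" "\<not> D \<subseteq> {Suc a..<j}" for D
  proof
    fix x assume x: "x \<in> D"
    obtain y where y: "y \<in> D" "y \<notin> {Suc a..<j}" using D(3) by blast
    have "y \<noteq> a" "y \<noteq> j" "x \<noteq> a" using x y disj[OF D(1,2)] B by blast+
    then have "y > j" "x > a" using y sub[OF D(1)] x by fastforce+
    have "\<not> x < j"
      using noncrossingD[OF p(2) B(1) D(1), of a x j y] D(2) B x y \<open>y > j\<close> \<open>x > a\<close> by auto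
    then show "x \<in> {j..<b}" using sub[OF D(1)] x by auto
  qed
  have B': "B - {a} \<subseteq> {j..<b}"
    using sub[OF B(1)] B(4) by fastforce
  have nB: "\<not> B \<subseteq> {Suc a..<j}" using B by auto
  define R where "R = {D \<in> \<pi>. D \<noteq> B \<and> \<not> D \<subseteq> {Suc a..<j}}"
  have not_root: "a \<notin> D" "j \<notin> D" if "D \<in> R" for D
    using disj[of D] that B by (auto simp: R_def)
  have \<tau>_eq: "\<tau> = insert (B - {a}) R"
  proof -
    have "{D \<in> \<pi>. \<not> D \<subseteq> {Suc a..<j}} = insert B R" using nB B(1) by (auto simp: R_def)
    moreover have "(\<lambda>D. D - {a}) ` R = id ` R" using not_root by (intro image_cong) auto
    ultimately show ?thesis by (simp add: \<tau>_def)
  qed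
  have Us: "\<Union>\<sigma> = {Suc a..<j}"
  proof
    show "\<Union>\<sigma> \<subseteq> {Suc a..<j}" by (auto simp: \<sigma>_def)
    show "{Suc a..<j} \<subseteq> \<Union>\<sigma>"
    proof
      fix x assume x: "x \<in> {Suc a..<j}"
      then have "x \<in> \<Union>\<pi>" using partition_onD1[OF p(1)] jb by auto
      then obtain D where D: "D \<in> \<pi>" "x \<in> D" by blast
      have "D \<noteq> B" using D x B(4) by auto
      then have "D \<subseteq> {Suc a..<j}" using upper[OF D(1)] D(2) x by force
      then show "x \<in> \<Union>\<sigma>" using D by (auto simp: \<sigma>_def)
    qed
  qed
  have Ut: "\<Union>\<tau> = {j..<b}"
  proof
    show "\<Union>\<tau> \<subseteq> {j..<b}" using upper B' by (auto simp: \<tau>_eq R_def)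
    show "{j..<b} \<subseteq> \<Union>\<tau>"
    proof
      fix x assume x: "x \<in> {j..<b}"
      then have "x \<in> \<Union>\<pi>" using partition_onD1[OF p(1)] aj by auto
      then obtain D where D: "D \<in> \<pi>" "x \<in> D" by blast
      then have "\<not> D \<subseteq> {Suc a..<j}" "x \<in> D - {a}" using x aj by auto
      then show "x \<in> \<Union>\<tau>" using D by (auto simp: \<tau>_def)
    qed
  qed
  show "\<sigma> \<in> NCP {Suc a..<j}"
  proof -
    have "disjoint \<sigma>" using partition_onD2[OF p(1)] by (auto simp: pairwise_def \<sigma>_def)
    moreover have "{} \<notin> \<sigma>" using partition_onD3[OF p(1)] by (simp add: \<sigma>_def)
    moreover have "noncrossing \<sigma>" by (rule noncrossing_subset[OF p(2)]) (auto simp: \<sigma>_def)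
    ultimately show ?thesis using Us by (simp add: NCP_def partition_on_def)
  qed
  show "\<tau> \<in> NCP {j..<b}"
  proof -
    have "B - {a} \<noteq> {}" using B aj by auto
    then have "{} \<notin> \<tau>" using partition_onD3[OF p(1)] by (auto simp: \<tau>_eq R_def)
    moreover have "disjnt (D - {a}) (E - {a})" if "D \<in> \<pi>" "E \<in> \<pi>" "D \<noteq> E" for D E
      using disjointD[OF partition_onD2[OF p(1)] that] by (auto simp: disjnt_def)
    then have "disjoint \<tau>" unfolding \<tau>_def pairwise_def by auto
    moreover have "noncrossing \<tau>" unfolding \<tau>_def
      by (rule noncrossing_shrink, rule noncrossing_subset[OF p(2)]) auto
    ultimately show ?thesis using Ut by (simp add: NCP_def partition_on_def)
  qed
  have "attach a j (B - {a}) = B" using B aj by (auto simp: attach_def)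
  moreover have "attach a j ` R = id ` R"
    using not_root by (intro image_cong) (auto simp: attach_def)
  ultimately have "attach a j ` \<tau> = insert B R" by (simp add: \<tau>_eq)
  then show "\<sigma> \<union> attach a j ` \<tau> = \<pi>" using B(1) by (auto simp: \<sigma>_def R_def)
qed

text \<open>
  The root block of the right part gains one element by the gluing, whence the shift of \<open>c\<close>.
\<close>

lemma rooted_weight_glue:
  fixes c \<kappa> :: "nat \<Rightarrow> 'a::comm_monoid_mult"
  assumes \<sigma>: "\<sigma> \<in> NCP {Suc a..<j}" and \<tau>: "\<tau> \<in> NCP {j..<b}"
  shows "rooted_weight c \<kappa> a (\<sigma> \<union> attach a j ` \<tau>) =
    rooted_weight \<kappa> \<kappa> (Suc a) \<sigma> * rooted_weight (\<lambda>k. c (Suc k)) \<kappa> j \<tau>"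
proof -
  have s: "D \<subseteq> {Suc a..<j}" if "D \<in> \<sigma>" for D using \<sigma> that by (auto simp: partition_on_def NCP_def)
  have t: "D \<subseteq> {j..<b}" "D \<noteq> {}" if "D \<in> \<tau>" for D
    using \<tau> that by (auto simp: partition_on_def NCP_def)
  have fin: "finite \<sigma>" "finite \<tau>"
    using \<sigma> \<tau> finite_elements by (auto simp: NCP_def)
  have at: "a \<notin> D" if "D \<in> \<tau>" for D using t(1)[OF that] aj by auto
  have "attach a j D \<notin> \<sigma>" if "D \<in> \<tau>" for D
  proof
    assume "attach a j D \<in> \<sigma>"
    from s[OF this] have "D \<subseteq> {Suc a..<j}" by (auto simp: attach_def split: if_splits)
    with t[OF that] show False by fastforce
  qed
  then have disj: "\<sigma> \<inter> attach a j ` \<tau> = {}" by blast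
  have inj: "inj_on (attach a j) \<tau>"
    using at attach_minus by (intro inj_on_inverseI[of _ "\<lambda>D. D - {a}"]) auto
  let ?w = "\<lambda>B. if a \<in> B then c (card B) else \<kappa> (card B)"
  have "rooted_weight c \<kappa> a (\<sigma> \<union> attach a j ` \<tau>) = prod ?w \<sigma> * prod ?w (attach a j ` \<tau>)"
    unfolding rooted_weight_def using fin disj by (intro prod.union_disjoint) auto
  also have "prod ?w \<sigma> = rooted_weight \<kappa> \<kappa> (Suc a) \<sigma>"
    unfolding rooted_weight_def using s by (intro prod.cong) fastforce+
  also have "prod ?w (attach a j ` \<tau>) = (\<Prod>D\<in>\<tau>. ?w (attach a j D))"
    using prod.reindex[OF inj] by simp
  also have "\<dots> = rooted_weight (\<lambda>k. c (Suc k)) \<kappa> j \<tau>"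
    unfolding rooted_weight_def
  proof (rule prod.cong)
    fix D assume D: "D \<in> \<tau>"
    have "finite D" using t(1)[OF D] finite_subset by blast
    then show "?w (attach a j D) = (if j \<in> D then c (Suc (card D)) else \<kappa> (card D))"
      using at[OF D] by (simp add: attach_def)
  qed simp
  finally show ?thesis .
qed

lemma sum_first_return:
  fixes c \<kappa> :: "nat \<Rightarrow> 'a::comm_semiring_1"
  shows "(\<Sum>\<pi> | \<pi> \<in> NCP {a..<b} \<and> first_return a j \<pi>. rooted_weight c \<kappa> a \<pi>) =
    rooted_sum \<kappa> \<kappa> (Suc a) j * rooted_sum (\<lambda>k. c (Suc k)) \<kappa> j b"
proof -
  define glue where "glue = (\<lambda>(\<sigma>, \<tau>). \<sigma> \<union> attach a j ` \<tau>)"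
  define split where
    "split = (\<lambda>\<pi>. ({D \<in> \<pi>. D \<subseteq> {Suc a..<j}}, (\<lambda>D. D - {a}) ` {D \<in> \<pi>. \<not> D \<subseteq> {Suc a..<j}}))"
  let ?P = "NCP {Suc a..<j} \<times> NCP {j..<b}"
  have "split (glue p) = p" if "p \<in> ?P" for p
    using that by (cases p) (simp only: glue_def split_def prod.case split_glue mem_Times_iff fst_conv snd_conv)
  then have inj: "inj_on glue ?P" by (rule inj_on_inverseI)
  have img: "{\<pi> \<in> NCP {a..<b}. first_return a j \<pi>} = glue ` ?P"
  proof (intro equalityI subsetI)
    fix \<pi> assume "\<pi> \<in> {\<pi> \<in> NCP {a..<b}. first_return a j \<pi>}"
    then have \<pi>: "\<pi> \<in> NCP {a..<b}" "first_return a j \<pi>" by simp_all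
    have "\<pi> = glue (split \<pi>)"
      by (simp only: glue_def split_def prod.case split_in_NCP(3)[OF \<pi>])
    moreover have "split \<pi> \<in> ?P"
      unfolding split_def mem_Times_iff fst_conv snd_conv using split_in_NCP(1,2)[OF \<pi>] by (rule conjI)
    ultimately show "\<pi> \<in> glue ` ?P" by (rule image_eqI)
  qed (auto simp: glue_def glue_in_NCP)
  have "(\<Sum>\<pi> | \<pi> \<in> NCP {a..<b} \<and> first_return a j \<pi>. rooted_weight c \<kappa> a \<pi>) =
    (\<Sum>(\<sigma>, \<tau>)\<in>?P. rooted_weight \<kappa> \<kappa> (Suc a) \<sigma> * rooted_weight (\<lambda>k. c (Suc k)) \<kappa> j \<tau>)"
    unfolding img sum.reindex[OF inj]
    by (rule sum.cong) (auto simp: glue_def rooted_weight_glue)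
  also have "\<dots> = rooted_sum \<kappa> \<kappa> (Suc a) j * rooted_sum (\<lambda>k. c (Suc k)) \<kappa> j b"
    unfolding rooted_sum_def by (simp add: sum_product sum.cartesian_product)
  finally show ?thesis .
qed

end

lemma sum_singleton_root:
  fixes c \<kappa> :: "nat \<Rightarrow> 'a::comm_semiring_1"
  assumes "a < b"
  shows "(\<Sum>\<pi> | \<pi> \<in> NCP {a..<b} \<and> {a} \<in> \<pi>. rooted_weight c \<kappa> a \<pi>) =
    c 1 * rooted_sum \<kappa> \<kappa> (Suc a) b"
proof -
  have na: "a \<notin> D" if "\<rho> \<in> NCP {Suc a..<b}" "D \<in> \<rho>" for \<rho> D
  proof -
    have "D \<subseteq> {Suc a..<b}" using that by (auto simp: NCP_def partition_on_def)
    then show ?thesis by auto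
  qed
  have "insert {a} \<rho> - {{a}} = \<rho>" if "\<rho> \<in> NCP {Suc a..<b}" for \<rho>
    using na[OF that, of "{a}"] by auto
  then have inj: "inj_on (insert {a}) (NCP {Suc a..<b})"
    by (rule inj_on_inverseI)
  have "rooted_weight c \<kappa> a (insert {a} \<rho>) = c 1 * rooted_weight \<kappa> \<kappa> (Suc a) \<rho>"
    if "\<rho> \<in> NCP {Suc a..<b}" for \<rho>
  proof -
    have "finite \<rho>" using that finite_elements by (auto simp: NCP_def)
    moreover have "{a} \<notin> \<rho>" using na[OF that] by blast
    moreover have "(\<Prod>B\<in>\<rho>. if a \<in> B then c (card B) else \<kappa> (card B)) = (\<Prod>B\<in>\<rho>. \<kappa> (card B))"
      using na[OF that] by (intro prod.cong) auto
    ultimately show ?thesis by (simp add: rooted_weight_def)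
  qed
  then show ?thesis
    unfolding NCP_singleton_root[OF assms] rooted_sum_def
    by (simp add: sum.reindex[OF inj] sum_distrib_left)
qed

lemma first_return_unique:
  assumes "\<pi> \<in> NCP S" "first_return a i \<pi>" "first_return a j \<pi>" "a < i" "a < j"
  shows "i = j"
proof -
  obtain B C where B: "B \<in> \<pi>" "a \<in> B" "i \<in> B" "B \<inter> {a<..<i} = {}"
    and C: "C \<in> \<pi>" "a \<in> C" "j \<in> C" "C \<inter> {a<..<j} = {}"
    using assms(2,3) unfolding first_return_def by blast
  have "B = C"
    using assms(1) B C disjointD[of \<pi> B C] by (auto simp: NCP_def partition_on_def)
  with B C assms(4,5) have "\<not> i < j" "\<not> j < i" by auto
  then show ?thesis by simp
qed

text \<open>
  The partitions are sorted by the second smallest element of the block of \<open>a\<close>, if there is one.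
\<close>

lemma rooted_sum_rec:
  fixes c \<kappa> :: "nat \<Rightarrow> 'a::comm_semiring_1"
  assumes "a < b"
  shows "rooted_sum c \<kappa> a b = c 1 * rooted_sum \<kappa> \<kappa> (Suc a) b +
    (\<Sum>j\<in>{a<..<b}. rooted_sum \<kappa> \<kappa> (Suc a) j * rooted_sum (\<lambda>k. c (Suc k)) \<kappa> j b)"
proof -
  let ?S = "{\<pi> \<in> NCP {a..<b}. {a} \<in> \<pi>}"
  let ?J = "\<lambda>j. {\<pi> \<in> NCP {a..<b}. first_return a j \<pi>}"
  have fin: "finite (NCP {a..<b})" by (simp add: finite_NCP)
  have "NCP {a..<b} \<subseteq> ?S \<union> (\<Union>j\<in>{a<..<b}. ?J j)"
  proof
    fix \<pi> assume \<pi>: "\<pi> \<in> NCP {a..<b}"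
    then have p: "partition_on {a..<b} \<pi>" by (simp add: NCP_def)
    have "a \<in> \<Union>\<pi>" using assms by (simp add: partition_onD1[OF p, symmetric])
    then obtain B where B: "B \<in> \<pi>" "a \<in> B" by blast
    have sub: "B \<subseteq> {a..<b}" using partition_onD1[OF p] B by blast
    show "\<pi> \<in> ?S \<union> (\<Union>j\<in>{a<..<b}. ?J j)"
    proof (cases "B = {a}")
      case True
      then show ?thesis using \<pi> B by simp
    next
      case False
      define j where "j = Min (B - {a})"
      have nonempty: "finite (B - {a})" "B - {a} \<noteq> {}" using sub finite_subset False B by auto
      have j: "j \<in> B - {a}" "\<And>x. x \<in> B - {a} \<Longrightarrow> j \<le> x"
        unfolding j_def using Min_in[OF nonempty] Min_le[OF nonempty(1)] by simp_all
      then have "B \<inter> {a<..<j} = {}" by fastforce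
      moreover have "j \<in> {a<..<b}" using j(1) sub by fastforce
      ultimately show ?thesis using \<pi> B j(1) unfolding first_return_def by blast
    qed
  qed
  then have eq: "NCP {a..<b} = ?S \<union> (\<Union>j\<in>{a<..<b}. ?J j)" by blast
  have disj: "?S \<inter> (\<Union>j\<in>{a<..<b}. ?J j) = {}"
  proof -
    have False if \<pi>: "\<pi> \<in> NCP {a..<b}" "{a} \<in> \<pi>" "first_return a j \<pi>" "a < j" for \<pi> j
    proof -
      obtain B where B: "B \<in> \<pi>" "a \<in> B" "j \<in> B" using \<pi>(3) unfolding first_return_def by blast
      have "B = {a}"
        using \<pi>(1,2) B disjointD[of \<pi> B "{a}"] by (auto simp: NCP_def partition_on_def)
      then show False using B(3) \<pi>(4) by simp
    qed
    then show ?thesis by auto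
  qed
  have "rooted_sum c \<kappa> a b = sum (rooted_weight c \<kappa> a) ?S +
      sum (rooted_weight c \<kappa> a) (\<Union>j\<in>{a<..<b}. ?J j)"
    unfolding rooted_sum_def
    by (subst eq, rule sum.union_disjoint) (use fin disj in \<open>auto intro: finite_subset[OF _ fin]\<close>)
  also have "sum (rooted_weight c \<kappa> a) (\<Union>j\<in>{a<..<b}. ?J j) =
      (\<Sum>j\<in>{a<..<b}. sum (rooted_weight c \<kappa> a) (?J j))"
  proof (intro sum.UNION_disjoint ballI impI)
    fix i j assume "i \<in> {a<..<b}" "j \<in> {a<..<b}" "i \<noteq> j"
    then show "?J i \<inter> ?J j = {}"
      using first_return_unique[of _ "{a..<b}" a i j] by auto
  qed (use fin in auto)
  finally show ?thesis by (simp add: sum_singleton_root[OF assms] sum_first_return)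
qed

section \<open>Moments and free cumulants\<close>

text \<open>
  The moment series belonging to the free cumulants \<open>\<kappa> 1, \<kappa> 2, \<dots>\<close>. The empty partition gives
  it the constant term \<open>1\<close>.
\<close>

definition nc_moments :: "(nat \<Rightarrow> 'a::comm_ring_1) \<Rightarrow> 'a fps" where
  "nc_moments \<kappa> = Abs_fps (\<lambda>n. \<Sum>\<pi>\<in>NC n. \<Prod>B\<in>\<pi>. \<kappa> (card B))"

lemma nc_moments_nth_0 [simp]: "nc_moments \<kappa> $ 0 = 1"
  by (simp add: nc_moments_def NC_eq_NCP NCP_empty)

lemma rooted_sum_eq_nc_moments:
  assumes "a \<le> b"
  shows "rooted_sum \<kappa> \<kappa> a b = nc_moments \<kappa> $ (b - a)"
proof -
  have "rooted_sum \<kappa> \<kappa> a b = rooted_sum \<kappa> \<kappa> (0 + a) (b - a + a)" using assms by simp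
  also have "\<dots> = rooted_sum \<kappa> \<kappa> 0 (b - a)" by (rule rooted_sum_shift)
  also have "\<dots> = rooted_sum \<kappa> \<kappa> (0 + 1) (b - a + 1)" by (rule rooted_sum_shift[symmetric])
  also have "\<dots> = nc_moments \<kappa> $ (b - a)"
    by (simp add: nc_moments_def rooted_sum_def NC_eq_NCP rooted_weight_same)
  finally show ?thesis .
qed

definition rooted_fps :: "(nat \<Rightarrow> 'a::comm_ring_1) \<Rightarrow> (nat \<Rightarrow> 'a) \<Rightarrow> 'a fps" where
  "rooted_fps c \<kappa> = Abs_fps (\<lambda>n. if n = 0 then 0 else rooted_sum c \<kappa> 0 n)"

text \<open>
  The recursion \<open>rooted_sum_rec\<close> in terms of generating functions: the element \<open>a\<close> contributes
  the factor \<open>X\<close>, the gap after it a moment series, and the block of \<open>a\<close> either ends here or goes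
  on with shifted weights.
\<close>

lemma rooted_fps_rec:
  "rooted_fps c \<kappa> =
    fps_X * nc_moments \<kappa> * (fps_const (c 1) + rooted_fps (\<lambda>k. c (Suc k)) \<kappa>)"
proof (rule fps_ext)
  fix n
  let ?c = "\<lambda>k. c (Suc k)"
  show "rooted_fps c \<kappa> $ n =
      (fps_X * nc_moments \<kappa> * (fps_const (c 1) + rooted_fps ?c \<kappa>)) $ n"
  proof (cases n)
    case 0
    then show ?thesis by (simp add: rooted_fps_def mult.assoc)
  next
    case (Suc m)
    have shift: "rooted_sum ?c \<kappa> j (Suc m) = rooted_sum ?c \<kappa> 0 (Suc m - j)"
      if "j < Suc m" for j
      using rooted_sum_shift[of ?c \<kappa> 0 j "Suc m - j"] that by simp
    have "rooted_fps c \<kappa> $ n = c 1 * nc_moments \<kappa> $ m +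
        (\<Sum>j\<in>{0<..<Suc m}. nc_moments \<kappa> $ (j - 1) * rooted_sum ?c \<kappa> j (Suc m))"
      by (simp add: Suc rooted_fps_def rooted_sum_rec rooted_sum_eq_nc_moments)
    also have "(\<Sum>j\<in>{0<..<Suc m}. nc_moments \<kappa> $ (j - 1) * rooted_sum ?c \<kappa> j (Suc m)) =
        (\<Sum>i<m. nc_moments \<kappa> $ i * rooted_sum ?c \<kappa> 0 (m - i))"
      by (rule sum.reindex_bij_witness[of _ Suc "\<lambda>j. j - 1"]) (auto simp: shift)
    also have "\<dots> = (\<Sum>i<m. nc_moments \<kappa> $ i * rooted_fps ?c \<kappa> $ (m - i))"
      by (rule sum.cong) (auto simp: rooted_fps_def)
    also have "\<dots> = (\<Sum>i\<in>{0..m}. nc_moments \<kappa> $ i * rooted_fps ?c \<kappa> $ (m - i))"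
      by (rule sum.mono_neutral_left) (auto simp: rooted_fps_def)
    finally show ?thesis
      by (simp add: Suc mult.assoc distrib_left fps_mult_nth[of "nc_moments \<kappa>" "rooted_fps ?c \<kappa>"] mult.commute[of _ "c 1"]
        fps_mult_right_const_nth)
  qed
qed

lemma rooted_fps_expand:
  fixes \<kappa> :: "nat \<Rightarrow> 'a::comm_ring_1"
  defines "P \<equiv> fps_X * nc_moments \<kappa>"
  shows "rooted_fps c \<kappa> = (\<Sum>k=1..K. fps_const (c k) * P ^ k) + P ^ K * rooted_fps (\<lambda>k. c (k + K)) \<kappa>"
proof (induction K)
  case 0
  then show ?case by simp
next
  case (Suc K)
  have "rooted_fps (\<lambda>k. c (k + K)) \<kappa> = P * (fps_const (c (Suc K)) + rooted_fps (\<lambda>k. c (k + Suc K)) \<kappa>)"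
    using rooted_fps_rec[of "\<lambda>k. c (k + K)" \<kappa>] by (simp add: P_def)
  with Suc.IH show ?case by (simp add: algebra_simps)
qed

text \<open>
  Speicher's equation \<open>M(z) = K(z M(z))\<close>. A root block with \<open>k\<close> elements contributes
  \<open>\<kappa> k (z M(z))\<^sup>k\<close>; in degree \<open>n\<close> the remainder after \<open>n\<close> elements has disappeared. The constant
  term \<open>1\<close> of \<open>K\<close> accounts for the empty partition.
\<close>

lemma nc_moments_functional_equation:
  fixes \<kappa> :: "nat \<Rightarrow> 'a::comm_ring_1"
  shows "nc_moments \<kappa> = Abs_fps (\<kappa>(0 := 1)) oo (fps_X * nc_moments \<kappa>)"
proof (rule fps_ext)
  fix n
  let ?P = "fps_X * nc_moments \<kappa>"
  have P0: "?P $ 0 = 0" by simp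
  show "nc_moments \<kappa> $ n = (Abs_fps (\<kappa>(0 := 1)) oo ?P) $ n"
  proof (cases "n = 0")
    case False
    have "nc_moments \<kappa> $ n = rooted_fps \<kappa> \<kappa> $ n"
      using False by (simp add: rooted_fps_def rooted_sum_eq_nc_moments)
    also have "\<dots> = (\<Sum>k=1..n. \<kappa> k * (?P ^ k) $ n) + (?P ^ n * rooted_fps (\<lambda>k. \<kappa> (k + n)) \<kappa>) $ n"
      by (subst rooted_fps_expand[of _ _ n]) (simp add: fps_sum_nth)
    also have "(?P ^ n * rooted_fps (\<lambda>k. \<kappa> (k + n)) \<kappa>) $ n = 0"
      unfolding fps_mult_nth
    proof (rule sum.neutral, rule ballI)
      fix i assume "i \<in> {0..n}"
      then show "(?P ^ n) $ i * rooted_fps (\<lambda>k. \<kappa> (k + n)) \<kappa> $ (n - i) = 0"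
        using startsby_zero_power_prefix[OF P0] by (cases "i < n") (auto simp: rooted_fps_def)
    qed
    also have "(\<Sum>k=1..n. \<kappa> k * (?P ^ k) $ n) + 0 = (\<Sum>k=0..n. (\<kappa>(0 := 1)) k * (?P ^ k) $ n)"
      using False by (simp add: sum.atLeast_Suc_atMost[of 0 n])
    finally show ?thesis by (simp add: fps_compose_nth)
  qed simp
qed

lemma fps_inv_unique:
  fixes a b :: "'a::field fps"
  assumes "a $ 0 = 0" "a $ 1 \<noteq> 0" "b $ 0 = 0" "a oo b = fps_X"
  shows "b = fps_inv a"
proof -
  have "fps_inv a oo (a oo b) = fps_inv a oo a oo b"
    using assms by (intro fps_compose_assoc) auto
  then show ?thesis using assms by (simp add: fps_inv)
qed

text \<open>
  The equation \<open>N = K(zN)\<close> says that \<open>P = zN\<close> satisfies \<open>P = z K(P)\<close>, that is \<open>P / K(P) = z\<close>.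
  So \<open>P\<close> is the compositional inverse of \<open>z / K(z)\<close>, and \<open>K\<close> determines it.
\<close>

lemma nc_moments_unique:
  fixes K N :: "'a::field fps"
  assumes "K $ 0 = 1" "N $ 0 = 1" "N = K oo (fps_X * N)"
  shows "fps_X * N = fps_inv (fps_X * inverse K)"
proof (rule fps_inv_unique)
  let ?P = "fps_X * N"
  have "(fps_X * inverse K) oo ?P = ?P * (inverse K oo ?P)"
    by (simp add: fps_compose_mult_distrib)
  also have "inverse K oo ?P = inverse N"
    using assms by (simp add: fps_inverse_compose)
  also have "?P * inverse N = fps_X" using assms(2) by (simp add: mult.assoc inverse_mult_eq_1')
  finally show "(fps_X * inverse K) oo ?P = fps_X" .
qed (use assms in auto)

lemma nc_moments_eq_inverse:
  fixes \<kappa> :: "nat \<Rightarrow> 'a::field"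
  shows "fps_X * nc_moments \<kappa> = fps_inv (fps_X * inverse (Abs_fps (\<kappa>(0 := 1))))"
  by (rule nc_moments_unique) (simp_all add: nc_moments_functional_equation[symmetric])

lemma moments_cumulants_iff:
  fixes R N :: "'a::field fps"
  assumes "R $ 0 = 0" "N $ 0 = 1"
  shows "nc_moments (fps_nth R) = N \<longleftrightarrow> N = (1 + R) oo (fps_X * N)"
proof -
  have R: "Abs_fps ((fps_nth R)(0 := 1)) = 1 + R" using assms(1) by (simp add: fps_eq_iff)
  show ?thesis
  proof
    assume *: "nc_moments (fps_nth R) = N"
    show "N = (1 + R) oo (fps_X * N)"
      using nc_moments_functional_equation[of "fps_nth R"] unfolding * R .
  next
    assume "N = (1 + R) oo (fps_X * N)"
    with assms have "fps_X * N = fps_inv (fps_X * inverse (1 + R))"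
      by (intro nc_moments_unique) auto
    also have "\<dots> = fps_X * nc_moments (fps_nth R)" by (simp add: nc_moments_eq_inverse R)
    finally show "nc_moments (fps_nth R) = N" by simp
  qed
qed

section \<open>The R-transform and the S-transform\<close>

lemma S_transform_props:
  assumes "\<mu> \<in> G1"
  shows "fps_X * S_transform \<mu> = (1 + fps_X) * fps_inv (M_series \<mu>)" "S_transform \<mu> $ 0 = 1"
proof -
  have M: "M_series \<mu> $ 0 = 0" "M_series \<mu> $ 1 = 1" by (simp_all add: M_series_def)
  let ?\<chi> = "fps_inv (M_series \<mu>)"
  have "?\<chi> $ 0 = 0" by (simp add: fps_inv_def)
  then have "((1 + fps_X) * ?\<chi>) $ 0 = 0" by simp
  then have "fps_shift 1 ((1 + fps_X) * ?\<chi>) * fps_X = (1 + fps_X) * ?\<chi>"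
    by (auto simp: fps_eq_iff fps_X_mult_right_nth)
  then have "fps_X dvd (1 + fps_X) * ?\<chi>" by (metis dvd_triv_right)
  then show *: "fps_X * S_transform \<mu> = (1 + fps_X) * ?\<chi>"
    unfolding S_transform_def by (rule dvd_mult_div_cancel)
  have "?\<chi> $ 1 = 1" using M by (simp add: fps_inv_def)
  then have "(fps_X * S_transform \<mu>) $ 1 = 1"
    unfolding * using \<open>?\<chi> $ 0 = 0\<close> by (simp add: distrib_right)
  then show "S_transform \<mu> $ 0 = 1" by simp
qed

text \<open>
  With \<open>\<Psi>\<close> for the moment series without constant term, the cumulant series is characterized by
  \<open>R(z(1 + \<Psi>(z))) = \<Psi>(z)\<close>. Substituting the inverse \<open>\<chi>\<close> of \<open>\<Psi>\<close> for \<open>z\<close> turns this into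
  \<open>R(\<chi>(z)(1 + z)) = z\<close>, and \<open>\<chi>(z)(1 + z) = z S(z)\<close>.
\<close>

theorem R_transform_eq_fps_inv:
  assumes "\<mu> \<in> G1"
  shows "R_transform \<mu> = fps_inv (fps_X * S_transform \<mu>)"
proof -
  define \<Psi> where "\<Psi> = M_series \<mu>"
  define P where "P = fps_X * (1 + \<Psi>)"
  define \<chi> where "\<chi> = fps_inv \<Psi>"
  define R where "R = \<Psi> oo fps_inv P"
  have \<Psi>: "\<Psi> $ 0 = 0" "\<Psi> $ 1 = 1" by (simp_all add: \<Psi>_def M_series_def)
  have mom: "\<Psi> $ n = \<mu> (monom 1 n)" if "n \<ge> 1" for n
    using assms that by (cases "n = 1") (auto simp: \<Psi>_def M_series_def G1_def)
  have P: "P $ 0 = 0" "P $ 1 = 1" using \<Psi> by (simp_all add: P_def)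
  have invP: "fps_inv P $ 0 = 0" by (simp add: fps_inv_def)
  have \<chi>0: "\<chi> $ 0 = 0" by (simp add: \<chi>_def fps_inv_def)
  \<comment> \<open>The defining property of the R-transform, as a composition equation that can be solved.\<close>
  have spec: "(R' $ 0 = 0 \<and> (\<forall>n\<ge>1. \<mu> (monom 1 n) = (\<Sum>\<pi>\<in>NC n. \<Prod>B\<in>\<pi>. R' $ card B))) \<longleftrightarrow>
      R' $ 0 = 0 \<and> R' oo P = \<Psi>" for R'
  proof (rule conj_cong[OF refl])
    assume R': "R' $ 0 = 0"
    have "(\<forall>n\<ge>1. \<mu> (monom 1 n) = (\<Sum>\<pi>\<in>NC n. \<Prod>B\<in>\<pi>. R' $ card B)) \<longleftrightarrow>
        nc_moments (fps_nth R') = 1 + \<Psi>"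
    proof -
      have "nc_moments (fps_nth R') = 1 + \<Psi> \<longleftrightarrow>
          (\<forall>n\<ge>1. nc_moments (fps_nth R') $ n = (1 + \<Psi>) $ n)"
        using \<Psi>(1) by (auto simp: fps_eq_iff Suc_le_eq)
      then show ?thesis using mom by (auto simp: nc_moments_def)
    qed
    also have "\<dots> \<longleftrightarrow> 1 + \<Psi> = (1 + R') oo P"
      unfolding P_def using R' \<Psi> by (intro moments_cumulants_iff) auto
    also have "\<dots> \<longleftrightarrow> R' oo P = \<Psi>" by (auto simp: fps_compose_add_distrib)
    finally show "(\<forall>n\<ge>1. \<mu> (monom 1 n) = (\<Sum>\<pi>\<in>NC n. \<Prod>B\<in>\<pi>. R' $ card B)) \<longleftrightarrow> R' oo P = \<Psi>" .
  qed
  have unique: "R' = R" if "R' oo P = \<Psi>" for R'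
    unfolding R_def that[symmetric]
    using P invP by (simp add: fps_compose_assoc[symmetric] fps_inv_right)
  have RP: "R oo P = \<Psi>"
    unfolding R_def using P invP by (simp add: fps_compose_assoc[symmetric] fps_inv)
  have "R_transform \<mu> = R"
    unfolding R_transform_def spec
  proof (rule the_equality)
    show "R $ 0 = 0 \<and> R oo P = \<Psi>" using RP \<Psi> by (simp add: R_def)
  qed (use unique in blast)
  define V where "V = fps_X * S_transform \<mu>"
  have V: "V $ 0 = 0" "V $ 1 = 1"
    using S_transform_props(2)[OF assms] by (simp_all add: V_def)
  have "P oo \<chi> = \<chi> * (1 + (\<Psi> oo \<chi>))"
    unfolding P_def using \<chi>0 by (simp add: fps_compose_mult_distrib fps_compose_add_distrib)
  also have "\<Psi> oo \<chi> = fps_X" unfolding \<chi>_def using \<Psi> by (intro fps_inv_right) auto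
  also have "\<chi> * (1 + fps_X) = V"
    using S_transform_props(1)[OF assms] by (simp add: V_def \<chi>_def \<Psi>_def mult.commute)
  finally have "R oo V = fps_X"
    using RP \<open>\<Psi> oo \<chi> = fps_X\<close> P \<chi>0 by (metis fps_compose_assoc)
  have "fps_inv V $ 0 = 0" by (simp add: fps_inv_def)
  have "R = R oo (V oo fps_inv V)" using V by (simp add: fps_inv_right)
  also have "\<dots> = R oo V oo fps_inv V"
    using V \<open>fps_inv V $ 0 = 0\<close> by (intro fps_compose_assoc)
  also have "\<dots> = fps_inv V" using \<open>R oo V = fps_X\<close> \<open>fps_inv V $ 0 = 0\<close> by simp
  finally show ?thesis using \<open>R_transform \<mu> = R\<close> by (simp add: V_def)
qed

text \<open>
  The moment series \<open>N\<close> of the cumulants \<open>1/S\<close> makes \<open>z N(z)\<close> the compositional inverse of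
  \<open>z / (1/S(z)) = z S(z)\<close>, which is also the inverse that gives the R-transform. So the cumulants
  of \<open>\<mu>\<close> are, with index shifted by one, the moments whose cumulants are the coefficients of \<open>1/S\<close>.
\<close>

theorem R_transform_nth:
  assumes "\<mu> \<in> G1"
  shows "R_transform \<mu> $ Suc n = nc_moments (fps_nth (inverse (S_transform \<mu>))) $ n"
proof -
  have S: "S_transform \<mu> $ 0 = 1" by (rule S_transform_props[OF assms])
  then have "Abs_fps ((fps_nth (inverse (S_transform \<mu>)))(0 := 1)) = inverse (S_transform \<mu>)"
    by (simp add: fps_eq_iff)
  then have "fps_X * nc_moments (fps_nth (inverse (S_transform \<mu>))) = R_transform \<mu>"
    using S by (simp add: nc_moments_eq_inverse R_transform_eq_fps_inv[OF assms])
  then show ?thesis by (metis fps_X_mult_nth diff_Suc_1 nat.distinct(1))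
qed

section \<open>Homomorphisms on the polynomial algebra\<close>

lemma vector_space_complex: "vector_space ((*) :: complex \<Rightarrow> complex \<Rightarrow> complex)"
  by unfold_locales (auto simp: algebra_simps)

lemma alg_hom_iff:
  assumes "vector_space s1" "vector_space s2"
  shows "alg_hom s1 s2 f \<longleftrightarrow> (\<forall>x y. f (x + y) = f x + f y) \<and> (\<forall>c x. f (s1 c x) = s2 c (f x)) \<and>
    f 1 = 1 \<and> (\<forall>x y. f (x * y) = f x * f y)"
  using assms by (auto simp: alg_hom_def Vector_Spaces.linear_iff)

lemma alg_homD:
  assumes "alg_hom s1 s2 f"
  shows "f (x + y) = f x + f y" "f (s1 c x) = s2 c (f x)" "f 1 = 1" "f (x * y) = f x * f y"
  using assms by (auto simp: alg_hom_def Vector_Spaces.linear_iff)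

lemma alg_hom_zero:
  assumes "alg_hom s1 s2 f"
  shows "f 0 = 0"
  using alg_homD(1)[OF assms, of 0 0] by simp

lemma alg_hom_diff:
  assumes "alg_hom s1 s2 f"
  shows "f (x - y) = f x - f y"
  using alg_homD(1)[OF assms, of "x - y" y] by simp

lemma alg_hom_sum:
  assumes "alg_hom s1 s2 f"
  shows "f (sum g A) = (\<Sum>x\<in>A. f (g x))"
  by (induction A rule: infinite_finite_induct) (simp_all add: alg_homD[OF assms] alg_hom_zero[OF assms])

lemma alg_hom_prod:
  fixes f :: "'a::comm_ring_1 \<Rightarrow> 'b::comm_ring_1"
  assumes "alg_hom s1 s2 f"
  shows "f (prod g A) = (\<Prod>x\<in>A. f (g x))"
  by (induction A rule: infinite_finite_induct) (simp_all add: alg_homD[OF assms])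

lemma alg_hom_comp:
  assumes "alg_hom s1 s2 f" "alg_hom s2 s3 g"
  shows "alg_hom s1 s3 (g \<circ> f)"
  using assms by (auto simp: alg_hom_def Vector_Spaces.linear_iff)

lemma poly_mapping_add_induct [case_names zero single add]:
  fixes p :: "'a \<Rightarrow>\<^sub>0 'b::comm_monoid_add"
  assumes "P 0" "\<And>k c. P (Poly_Mapping.single k c)" "\<And>p q. P p \<Longrightarrow> P q \<Longrightarrow> P (p + q)"
  shows "P p"
proof -
  have eq: "p = (\<Sum>k\<in>Poly_Mapping.keys p. Poly_Mapping.single k (Poly_Mapping.lookup p k))"
    by (rule poly_mapping_eqI) (auto simp: lookup_sum lookup_single when_def in_keys_iff)
  have "P (\<Sum>k\<in>K. Poly_Mapping.single k (Poly_Mapping.lookup p k))" for K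
    by (induction K rule: infinite_finite_induct) (use assms in auto)
  then show ?thesis by (subst eq)
qed

lemma Y1_scale_single: "Y1_scale c (Poly_Mapping.single M d) = Poly_Mapping.single M (c * d)"
  by (rule poly_mapping_eqI) (simp add: lookup_Y1_scale lookup_single when_def)

lemma Y1_hom_unique:
  assumes f: "alg_hom Y1_scale s f" and g: "alg_hom Y1_scale s g"
    and eq: "\<And>i. f (Poly_Mapping.single {#i#} 1) = g (Poly_Mapping.single {#i#} 1)"
  shows "f = g"
proof
  fix p
  have mono: "f (Poly_Mapping.single M 1) = g (Poly_Mapping.single M 1)" for M
  proof (induction M)
    case empty
    then show ?case using alg_homD(3)[OF f] alg_homD(3)[OF g] by simp
  next
    case (add i M)
    have "Poly_Mapping.single (add_mset i M) 1 =
        Poly_Mapping.single {#i#} 1 * (Poly_Mapping.single M 1 :: Y1)"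
      by (simp add: mult_single)
    then show ?case by (simp add: alg_homD(4)[OF f] alg_homD(4)[OF g] eq add.IH)
  qed
  show "f p = g p"
  proof (induction p rule: poly_mapping_add_induct)
    case (single M c)
    have "Poly_Mapping.single M c = Y1_scale c (Poly_Mapping.single M 1)"
      by (simp add: Y1_scale_single)
    then show ?case by (simp add: alg_homD(2)[OF f] alg_homD(2)[OF g] mono)
  qed (simp_all add: alg_homD(1)[OF f] alg_homD(1)[OF g] alg_hom_zero[OF f] alg_hom_zero[OF g])
qed

text \<open>
  The map \<open>f\<close> sends a monomial to the product of the values of its factors. Both sides of
  \<open>f (p * q) = f p * f q\<close> are bilinear, so it suffices to compare them at monomials.
\<close>

lemma Y1_hom_exists:
  fixes s :: "complex \<Rightarrow> 'b::comm_ring_1 \<Rightarrow> 'b"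
  assumes vs: "vector_space s" and s_mult: "\<And>c a b. s c a * b = s c (a * b)"
  shows "\<exists>f. alg_hom Y1_scale s f \<and> (\<forall>i. f (Poly_Mapping.single {#i#} 1) = v i)"
proof -
  interpret vector_space s by (rule vs)
  define m where "m M = prod_mset (image_mset v M)" for M
  define f where "f p = (\<Sum>M\<in>Poly_Mapping.keys p. s (Poly_Mapping.lookup p M) (m M))" for p :: Y1
  have f_eq: "f p = (\<Sum>M\<in>S. s (Poly_Mapping.lookup p M) (m M))"
    if "finite S" "Poly_Mapping.keys p \<subseteq> S" for p S
    unfolding f_def using that by (intro sum.mono_neutral_left) (auto simp: in_keys_iff)
  have f_add: "f (p + q) = f p + f q" for p q
    using f_eq[of "Poly_Mapping.keys p \<union> Poly_Mapping.keys q"] Poly_Mapping.keys_add[of p q]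
    by (simp add: lookup_add scale_left_distrib sum.distrib)
  have f_single: "f (Poly_Mapping.single M c) = s c (m M)" for M c
    using f_eq[of "{M}" "Poly_Mapping.single M c"] by (simp add: lookup_single)
  have f_0: "f 0 = 0" by (simp add: f_def)
  have m_add: "m (M + N) = m M * m N" for M N by (simp add: m_def)
  have f_scale: "f (Y1_scale c p) = s c (f p)" for c p
  proof (induction p rule: poly_mapping_add_induct)
    case (add p q)
    have "Y1_scale c (p + q) = Y1_scale c p + Y1_scale c q"
      by (rule poly_mapping_eqI) (simp add: lookup_Y1_scale lookup_add distrib_left)
    with add show ?case by (simp add: f_add scale_right_distrib)
  next
    case zero
    have "Y1_scale c 0 = 0" by (rule poly_mapping_eqI) (simp add: lookup_Y1_scale)
    then show ?case by (simp add: f_0)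
  qed (simp_all add: Y1_scale_single f_single)
  have s_mult': "a * s c b = s c (a * b)" for a b c
    using s_mult[of c b a] by (simp add: mult.commute)
  have f_mult: "f (p * q) = f p * f q" for p q
  proof (induction p rule: poly_mapping_add_induct)
    case (single M c)
    show ?case
    proof (induction q rule: poly_mapping_add_induct)
      case (single N d)
      show ?case by (simp add: mult_single f_single m_add s_mult s_mult')
    qed (simp_all add: f_0 f_add distrib_left)
  qed (simp_all add: f_0 f_add distrib_right)
  have "f 1 = 1" using f_single[of "{#}" 1] by (simp add: m_def)
  moreover have "f (Poly_Mapping.single {#i#} 1) = v i" for i by (simp add: f_single m_def)
  ultimately show ?thesis
    by (intro exI[of _ f]) (simp add: alg_hom_iff[OF vector_space_Y1 vs] f_add f_scale f_mult)
qed

lemma all_Y_iff: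
  "(\<forall>n\<ge>2. P n (Y n)) \<longleftrightarrow> (\<forall>i. P (nat_of_yindex i) (Poly_Mapping.single {#i#} 1))"
proof
  assume *: "\<forall>n\<ge>2. P n (Y n)"
  show "\<forall>i. P (nat_of_yindex i) (Poly_Mapping.single {#i#} 1)"
  proof
    fix i
    have "nat_of_yindex i \<ge> 2" using nat_of_yindex[of i] by simp
    with * show "P (nat_of_yindex i) (Poly_Mapping.single {#i#} 1)"
      by (metis Y_def nat_of_yindex_inverse)
  qed
next
  assume *: "\<forall>i. P (nat_of_yindex i) (Poly_Mapping.single {#i#} 1)"
  show "\<forall>n\<ge>2. P n (Y n)"
  proof (intro allI impI)
    fix n :: nat assume "n \<ge> 2"
    then have "nat_of_yindex (yindex n) = n" by (simp add: yindex_inverse)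
    then show "P n (Y n)" using * by (metis Y_def)
  qed
qed

theorem Y1_universal:
  fixes s :: "complex \<Rightarrow> 'b::comm_ring_1 \<Rightarrow> 'b"
  assumes vs: "vector_space s" and s_mult: "\<And>c a b. s c a * b = s c (a * b)"
  shows "\<exists>!f. alg_hom Y1_scale s f \<and> (\<forall>n\<ge>2. f (Y n) = v n)"
proof -
  have "\<exists>!f. alg_hom Y1_scale s f \<and> (\<forall>i. f (Poly_Mapping.single {#i#} 1) = v (nat_of_yindex i))"
    using Y1_hom_exists[OF assms, of "\<lambda>i. v (nat_of_yindex i)"] Y1_hom_unique[of s]
    by (metis (no_types, lifting))
  then show ?thesis using all_Y_iff[of "\<lambda>n y. f y = v n" for f] by simp
qed

section \<open>Generation of the symmetric functions\<close>

lemma sym_eqI: "(\<And>M. sym_coeff f M = sym_coeff g M) \<Longrightarrow> f = g"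
  by (metis ext sym_coeff_inject)

lemma sym_coeff_sum: "sym_coeff (sum f A) M = (\<Sum>x\<in>A. sym_coeff (f x) M)"
  by (induction A rule: infinite_finite_induct) (simp_all add: plus_sym.rep_eq zero_sym.rep_eq)

lemma sym_coeff_bij: "bij \<sigma> \<Longrightarrow> sym_coeff f (image_mset \<sigma> M) = sym_coeff f M"
  using sym_coeff[of f] by (simp add: is_sym_def)

text \<open>
  Homomorphisms out of the symmetric functions are handled degree by degree, because below a
  given degree only finitely many generators matter.
\<close>

definition sym_degree_le :: "sym \<Rightarrow> nat \<Rightarrow> bool" where
  "sym_degree_le f d \<longleftrightarrow> (\<forall>M. sym_coeff f M \<noteq> 0 \<longrightarrow> size M \<le> d)"

lemma sym_degree_le_exists: "\<exists>d. sym_degree_le f d"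
  using sym_coeff[of f] by (simp add: is_sym_def sym_degree_le_def)

lemma sym_degree_le_mono: "sym_degree_le f d \<Longrightarrow> d \<le> d' \<Longrightarrow> sym_degree_le f d'"
  unfolding sym_degree_le_def by (meson order_trans)

lemma sym_degree_le_elem: "sym_degree_le (elem_sym n) n"
  by (simp add: sym_degree_le_def elem_sym.rep_eq)

lemma sym_degree_le_add: "sym_degree_le f d \<Longrightarrow> sym_degree_le g d \<Longrightarrow> sym_degree_le (f + g) d"
  unfolding sym_degree_le_def plus_sym.rep_eq by (metis add_0)

lemma sym_degree_le_diff: "sym_degree_le f d \<Longrightarrow> sym_degree_le g d \<Longrightarrow> sym_degree_le (f - g) d"
  unfolding sym_degree_le_def minus_sym.rep_eq by (metis diff_0_right)

lemma sym_degree_le_scale: "sym_degree_le f d \<Longrightarrow> sym_degree_le (sym_scale c f) d"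
  unfolding sym_degree_le_def sym_scale.rep_eq by simp

lemma sym_degree_le_mult:
  assumes "sym_degree_le f d" "sym_degree_le g d'"
  shows "sym_degree_le (f * g) (d + d')"
  unfolding sym_degree_le_def
proof (intro allI impI)
  fix M assume "sym_coeff (f * g) M \<noteq> 0"
  then obtain A where A: "A \<subseteq># M" "sym_coeff f A * sym_coeff g (M - A) \<noteq> 0"
    unfolding times_sym.rep_eq conv_def by (metis (mono_tags, lifting) mem_Collect_eq sum.neutral)
  then have "size A \<le> d" "size (M - A) \<le> d'"
    using assms unfolding sym_degree_le_def by auto
  moreover have "size M = size A + size (M - A)"
    using A(1) by (metis size_union subset_mset.add_diff_inverse)
  ultimately show "size M \<le> d + d'" by linarith
qed

lemma squarefree_eq_mset_set:
  assumes "\<forall>i. count A i \<le> 1"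
  shows "mset_set (set_mset A) = A"
proof (rule multiset_eqI)
  fix i
  have "count A i \<le> 1" using assms by simp
  then show "count (mset_set (set_mset A)) i = count A i"
    by (cases "i \<in># A") (auto simp: not_in_iff count_greater_zero_iff[symmetric] simp del: count_greater_zero_iff)
qed

text \<open>
  The monomials occurring in elementary symmetric functions are squarefree, so they correspond to
  finite sets of variables.
\<close>

lemma squarefree_submsets:
  "{A. A \<subseteq># M \<and> (\<forall>i. count A i \<le> 1)} = mset_set ` Pow (set_mset M)"
proof (intro equalityI subsetI)
  fix A assume A: "A \<in> {A. A \<subseteq># M \<and> (\<forall>i. count A i \<le> 1)}"
  then have "A = mset_set (set_mset A)" by (simp add: squarefree_eq_mset_set)
  moreover have "set_mset A \<subseteq> set_mset M" using A set_mset_mono by auto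
  ultimately show "A \<in> mset_set ` Pow (set_mset M)" by blast
next
  fix A assume "A \<in> mset_set ` Pow (set_mset M)"
  then obtain X where X: "X \<subseteq> set_mset M" "A = mset_set X" by blast
  have "mset_set X \<subseteq># mset_set (set_mset M)"
    using X(1) by (intro subset_imp_msubset_mset_set) auto
  also have "\<dots> \<subseteq># M" by (rule mset_set_set_mset_msubset)
  finally show "A \<in> {A. A \<subseteq># M \<and> (\<forall>i. count A i \<le> 1)}"
    by (simp add: X(2) count_mset_set')
qed

lemma inj_on_mset_set: "finite S \<Longrightarrow> inj_on mset_set (Pow S)"
  by (intro inj_onI) (metis Pow_iff finite_set_mset_mset_set finite_subset)

lemma sum_squarefree_submsets:
  "(\<Sum>A | A \<subseteq># M. if \<forall>i. count A i \<le> 1 then F A else 0) = (\<Sum>X\<in>Pow (set_mset M). F (mset_set X))"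
proof -
  have "(\<Sum>A | A \<subseteq># M. if \<forall>i. count A i \<le> 1 then F A else 0) =
      (\<Sum>A | A \<subseteq># M \<and> (\<forall>i. count A i \<le> 1). F A)"
    by (subst sum.inter_filter[symmetric]) (simp_all add: finite_submsets)
  also have "\<dots> = (\<Sum>X\<in>Pow (set_mset M). F (mset_set X))"
    unfolding squarefree_submsets by (subst sum.reindex) (simp_all add: inj_on_mset_set)
  finally show ?thesis .
qed

lemma sym_coeff_elem_mult:
  "sym_coeff (elem_sym k * g) M =
    (\<Sum>X | X \<subseteq> set_mset M \<and> card X = k. sym_coeff g (M - mset_set X))"
proof -
  have "sym_coeff (elem_sym k * g) M = (\<Sum>A | A \<subseteq># M. if \<forall>i. count A i \<le> 1 then
      (if size A = k then sym_coeff g (M - A) else 0) else 0)"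
    unfolding times_sym.rep_eq conv_def elem_sym.rep_eq by (rule sum.cong) auto
  also have "\<dots> = (\<Sum>X\<in>Pow (set_mset M). if card X = k then sym_coeff g (M - mset_set X) else 0)"
    unfolding sum_squarefree_submsets by simp
  also have "\<dots> = (\<Sum>X | X \<subseteq> set_mset M \<and> card X = k. sym_coeff g (M - mset_set X))"
    by (subst sum.inter_filter[symmetric]) (auto intro!: sum.cong)
  finally show ?thesis .
qed

lemma sum_Pow_alternating:
  assumes "finite S" "S \<noteq> {}"
  shows "(\<Sum>X\<in>Pow S. (-1) ^ card X) = (0::'a::comm_ring_1)"
proof -
  have "(\<Sum>X\<in>Pow S. (-1) ^ card X) = (\<Prod>x\<in>S. - 1 + (1::'a))"
    using prod_add[OF assms(1), of "\<lambda>_. - 1" "\<lambda>_. 1 :: 'a"] by simp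
  then show ?thesis using assms by (simp add: zero_power card_gt_0_iff)
qed

lemma sym_coeff_sign: "sym_coeff ((-1) ^ i * f) M = (-1) ^ i * sym_coeff f M"
  by (cases "even i") (simp_all add: uminus_sym.rep_eq)

text \<open>
  The coefficient at a monomial of degree \<open>n\<close> with set of variables \<open>V\<close> is
  \<open>\<Sum>X\<subseteq>V. (-1)\<^bsup>|X|\<^esup>\<close>, and this vanishes since \<open>V\<close> is nonempty.
\<close>

lemma elem_complete_relation:
  assumes "n \<ge> 1"
  shows "(\<Sum>i\<le>n. (-1) ^ i * (elem_sym i * complete_sym (n - i))) = 0"
proof (rule sym_eqI)
  fix M :: "nat multiset"
  have card_le: "card X \<le> size M" "size (M - mset_set X) = size M - card X"
    if "X \<subseteq> set_mset M" for X
  proof -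
    have "mset_set X \<subseteq># M"
      using that squarefree_submsets[of M] by blast
    then show "card X \<le> size M" "size (M - mset_set X) = size M - card X"
      by (auto dest: size_mset_mono simp: size_Diff_submset)
  qed
  have "sym_coeff (\<Sum>i\<le>n. (-1) ^ i * (elem_sym i * complete_sym (n - i))) M =
      (\<Sum>i\<le>n. \<Sum>X | X \<in> Pow (set_mset M) \<and> card X = i.
        (-1) ^ card X * sym_coeff (complete_sym (n - card X)) (M - mset_set X))"
    unfolding sym_coeff_sum sym_coeff_sign sym_coeff_elem_mult sum_distrib_left
    by (intro sum.cong) auto
  also have "\<dots> = (\<Sum>i\<le>n. \<Sum>X | X \<in> Pow (set_mset M) \<and> card X = i.
        if size M = n then (-1) ^ card X else 0)"
  proof (intro sum.cong refl)
    fix i X assume "i \<in> {..n}" "X \<in> {X. X \<in> Pow (set_mset M) \<and> card X = i}"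
    then have X: "X \<subseteq> set_mset M" "card X \<le> n" by auto
    have "size (M - mset_set X) = n - card X \<longleftrightarrow> size M = n"
      unfolding card_le(2)[OF X(1)] using card_le(1)[OF X(1)] X(2) by linarith
    then show "(-1) ^ card X * sym_coeff (complete_sym (n - card X)) (M - mset_set X) =
        (if size M = n then (-1) ^ card X else 0)"
      by (simp add: complete_sym.rep_eq)
  qed
  also have "\<dots> = 0"
  proof (cases "size M = n")
    case True
    have "(\<Sum>i\<le>n. \<Sum>X | X \<in> Pow (set_mset M) \<and> card X = i. (-1) ^ card X) =
        (\<Sum>X\<in>Pow (set_mset M). (-1) ^ card X :: complex)"
      using card_le True by (intro sum.group) auto
    also have "\<dots> = 0" using True assms by (intro sum_Pow_alternating) auto
    finally show ?thesis using True by simp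
  qed simp
  finally show "sym_coeff (\<Sum>i\<le>n. (-1) ^ i * (elem_sym i * complete_sym (n - i))) M = sym_coeff 0 M"
    by (simp add: zero_sym.rep_eq)
qed

text \<open>
  The bijection swaps \<open>S - S'\<close> with \<open>S' - S\<close> and fixes everything else.
\<close>

lemma exchange_bij:
  assumes "finite S" "finite S'" "card S = card S'" "A \<subseteq> S" "A \<subseteq> S'"
  obtains \<sigma> :: "'a \<Rightarrow> 'a" where "bij \<sigma>" "\<And>a. a \<in> A \<Longrightarrow> \<sigma> a = a" "\<sigma> ` S = S'"
proof -
  have "card (S - S') = card S - card (S \<inter> S')" "card (S' - S) = card S' - card (S \<inter> S')"
    using assms by (simp_all add: card_Diff_subset_Int Int_commute)
  then obtain h where h: "bij_betw h (S - S') (S' - S)"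
    using finite_same_card_bij[of "S - S'" "S' - S"] assms by auto
  define g where "g = the_inv_into (S - S') h"
  have h': "h x \<in> S' - S" "g (h x) = x" if "x \<in> S - S'" for x
    using h that by (auto simp: bij_betw_def g_def the_inv_into_f_f)
  have g': "g x \<in> S - S'" "h (g x) = x" if "x \<in> S' - S" for x
    using h that f_the_inv_into_f_bij_betw[OF h] bij_betw_the_inv_into[OF h]
    by (auto simp: g_def bij_betw_def)
  define \<sigma> where "\<sigma> x = (if x \<in> S - S' then h x else if x \<in> S' - S then g x else x)" for x
  have inv: "\<sigma> (\<sigma> x) = x" for x
    using h'[of x] g'[of x] by (auto simp: \<sigma>_def)
  then have bij: "bij \<sigma>" by (rule involuntory_imp_bij)
  have "\<sigma> ` S \<subseteq> S'" "\<sigma> ` S' \<subseteq> S"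
    using h' g' by (auto simp: \<sigma>_def)
  then have "\<sigma> ` S = S'" using inv by (metis image_subset_iff subsetI subset_antisym image_eqI)
  with bij assms show ?thesis by (intro that[of \<sigma>]) (auto simp: \<sigma>_def)
qed

lemma sym_coeff_exchange:
  assumes "finite S" "finite S'" "card S = card S'" "set_mset N \<subseteq> S" "set_mset N \<subseteq> S'"
  shows "sym_coeff f (N + mset_set S) = sym_coeff f (N + mset_set S')"
proof -
  obtain \<sigma> where \<sigma>: "bij \<sigma>" "\<And>a. a \<in> set_mset N \<Longrightarrow> \<sigma> a = a" "\<sigma> ` S = S'"
    using exchange_bij[OF assms] by blast
  have "image_mset \<sigma> N = image_mset id N" by (rule image_mset_cong) (simp add: \<sigma>(2))
  moreover have "image_mset \<sigma> (mset_set S) = mset_set S'"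
    using \<sigma> by (simp add: image_mset_mset_set inj_on_subset[OF bij_is_inj])
  ultimately show ?thesis using sym_coeff_bij[OF \<sigma>(1), of f "N + mset_set S"] by simp
qed

definition sym_support_ge :: "sym \<Rightarrow> nat \<Rightarrow> bool" where
  "sym_support_ge f k \<longleftrightarrow> (\<forall>M. sym_coeff f M \<noteq> 0 \<longrightarrow> k \<le> card (set_mset M))"

text \<open>
  The reduction behind the fundamental theorem of symmetric functions. A monomial with exactly \<open>k\<close>
  variables is a multiple of exactly one squarefree monomial of degree \<open>k\<close>. If \<open>g\<close> takes at \<open>N\<close>
  the coefficient of \<open>f\<close> at \<open>N\<close> times a squarefree monomial of degree \<open>k\<close> containing all variables
  of \<open>N\<close>, the product of \<open>e\<^sub>k\<close> with \<open>g\<close> therefore agrees with \<open>f\<close> on the monomials in at most \<open>k\<close>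
  variables; on those in fewer than \<open>k\<close> variables both vanish. By symmetry of \<open>f\<close> the choice of the squarefree monomial does not matter.
\<close>

lemma elem_quotient_exists:
  assumes supp: "sym_support_ge f k" and deg: "sym_degree_le f d"
  shows "\<exists>g. sym_degree_le g (d - k) \<and> sym_support_ge (f - elem_sym k * g) (Suc k)"
proof -
  define ext where "ext N S \<longleftrightarrow> finite S \<and> set_mset N \<subseteq> S \<and> card S = k" for N :: "nat multiset" and S
  define G where "G N = (if card (set_mset N) \<le> k
      then sym_coeff f (N + mset_set (SOME S. ext N S)) else 0)" for N
  have G_eq: "G N = sym_coeff f (N + mset_set S)" if "ext N S" for N S
  proof -
    have "ext N (SOME S. ext N S)" using that by (rule someI)
    moreover have "card (set_mset N) \<le> k" using that card_mono unfolding ext_def by blast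
    ultimately show ?thesis
      using that unfolding G_def ext_def by (auto intro: sym_coeff_exchange)
  qed
  have ext_ex: "\<exists>S. ext N S" if "card (set_mset N) \<le> k" for N
  proof -
    have "infinite (UNIV - set_mset N)" by (simp add: Diff_infinite_finite)
    then obtain T where T: "T \<subseteq> UNIV - set_mset N" "finite T" "card T = k - card (set_mset N)"
      using infinite_arbitrarily_large by metis
    have "card (set_mset N \<union> T) = k"
      using T that by (subst card_Un_disjoint) auto
    then show ?thesis using T unfolding ext_def by (intro exI[of _ "set_mset N \<union> T"]) auto
  qed
  have G_deg: "size N \<le> d - k" if "G N \<noteq> 0" for N
  proof -
    have "card (set_mset N) \<le> k" using that unfolding G_def by presburger
    then obtain S where S: "ext N S" using ext_ex by blast
    then have "size (N + mset_set S) \<le> d"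
      using that G_eq[OF S] deg unfolding sym_degree_le_def by metis
    then show ?thesis using S unfolding ext_def by simp
  qed
  have G_bij: "G (image_mset \<sigma> N) = G N" if \<sigma>: "bij \<sigma>" for \<sigma> N
  proof (cases "card (set_mset N) \<le> k")
    case True
    then obtain S where S: "ext N S" using ext_ex by blast
    have inj: "inj_on \<sigma> T" for T using \<sigma> by (simp add: inj_on_subset[OF bij_is_inj])
    have "ext (image_mset \<sigma> N) (\<sigma> ` S)"
      using S inj unfolding ext_def by (auto simp: card_image)
    then have "G (image_mset \<sigma> N) = sym_coeff f (image_mset \<sigma> (N + mset_set S))"
      using G_eq inj by (simp add: image_mset_mset_set)
    then show ?thesis by (simp only: sym_coeff_bij[OF \<sigma>] G_eq[OF S])
  next
    case False
    moreover have "card (set_mset (image_mset \<sigma> N)) = card (set_mset N)"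
      using \<sigma> by (simp add: card_image inj_on_subset[OF bij_is_inj])
    ultimately show ?thesis by (simp add: G_def)
  qed
  have "is_sym G" unfolding is_sym_def using G_deg G_bij by blast
  then have coeff: "sym_coeff (Abs_sym G) = G" by (simp add: Abs_sym_inverse)
  have "sym_support_ge (f - elem_sym k * Abs_sym G) (Suc k)"
    unfolding sym_support_ge_def
  proof (intro allI impI)
    fix M assume nz: "sym_coeff (f - elem_sym k * Abs_sym G) M \<noteq> 0"
    show "Suc k \<le> card (set_mset M)"
    proof (rule ccontr)
      assume "\<not> Suc k \<le> card (set_mset M)"
      then consider "card (set_mset M) < k" | "card (set_mset M) = k" by linarith
      then have "sym_coeff (elem_sym k * Abs_sym G) M = sym_coeff f M"
      proof cases
        case 1
        then have "{X. X \<subseteq> set_mset M \<and> card X = k} = {}"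
          using card_mono[OF finite_set_mset] by (metis (mono_tags, lifting) empty_Collect_eq leD)
        moreover have "sym_coeff f M = 0" using supp 1 unfolding sym_support_ge_def by force
        ultimately show ?thesis by (simp only: sym_coeff_elem_mult sum.empty)
      next
        case 2
        then have "{X. X \<subseteq> set_mset M \<and> card X = k} = {set_mset M}"
          using card_subset_eq[OF finite_set_mset] by auto
        then have "sym_coeff (elem_sym k * Abs_sym G) M = G (M - mset_set (set_mset M))"
          by (simp add: sym_coeff_elem_mult coeff)
        also have "\<dots> = sym_coeff f (M - mset_set (set_mset M) + mset_set (set_mset M))"
          using 2 by (intro G_eq) (auto simp: ext_def dest: in_diffD)
        finally show ?thesis by (simp add: mset_set_set_mset_msubset)
      qed
      with nz show False by (simp add: minus_sym.rep_eq)
    qed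
  qed
  moreover have "sym_degree_le (Abs_sym G) (d - k)"
    using G_deg by (simp add: sym_degree_le_def coeff)
  ultimately show ?thesis by blast
qed

text \<open>
  The reason is that \<open>f\<close> is a polynomial in \<open>e\<^sub>1, \<dots>, e\<^sub>d\<close>. Subtracting multiples of
  \<open>e\<^sub>1, e\<^sub>2, \<dots>\<close> in turn raises the number of variables in all monomials of \<open>f\<close> until it exceeds the
  degree, so that nothing is left; the cofactors have smaller degree and are covered by induction.
\<close>

lemma sym_hom_eq_of_elem:
  assumes \<phi>: "alg_hom sym_scale (*) \<phi>" and \<psi>: "alg_hom sym_scale (*) \<psi>"
    and "\<And>n. 1 \<le> n \<Longrightarrow> n \<le> d \<Longrightarrow> \<phi> (elem_sym n) = \<psi> (elem_sym n)"
    and "sym_degree_le f d"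
  shows "\<phi> f = \<psi> f"
  using assms(3,4)
proof (induction d arbitrary: f rule: less_induct)
  case (less d)
  have step: "\<phi> f = \<psi> f"
    if "k \<le> Suc d" "1 \<le> k" "sym_degree_le f d" "sym_support_ge f k" for k f
    using that
  proof (induction k arbitrary: f rule: inc_induct)
    case base
    have "sym_coeff f M = 0" for M
    proof (rule ccontr)
      assume "sym_coeff f M \<noteq> 0"
      then have "size M \<le> d" "Suc d \<le> card (set_mset M)"
        using base unfolding sym_degree_le_def sym_support_ge_def by auto
      moreover have "card (set_mset M) \<le> size M"
        using size_mset_mono[OF mset_set_set_mset_msubset[of M]] by simp
      ultimately show False by simp
    qed
    then have "f = 0" by (intro sym_eqI) (simp add: zero_sym.rep_eq)
    then show ?case by (simp add: alg_hom_zero[OF \<phi>] alg_hom_zero[OF \<psi>])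
  next
    case (step k)
    then have k: "1 \<le> k" "k \<le> d" by simp_all
    obtain g where g: "sym_degree_le g (d - k)" "sym_support_ge (f - elem_sym k * g) (Suc k)"
      using elem_quotient_exists step.prems by blast
    have "sym_degree_le (elem_sym k * g) d"
      using sym_degree_le_mult[OF sym_degree_le_elem g(1), of k] k by simp
    then have "\<phi> (f - elem_sym k * g) = \<psi> (f - elem_sym k * g)"
      using step g by (intro step.IH) (auto intro: sym_degree_le_diff)
    moreover have "\<phi> g = \<psi> g"
    proof (rule less.IH[of "d - k"])
      show "d - k < d" using k by simp
      show "sym_degree_le g (d - k)" by (rule g(1))
      fix n assume "1 \<le> n" "n \<le> d - k"
      then show "\<phi> (elem_sym n) = \<psi> (elem_sym n)" by (intro less.prems(1)) simp_all
    qed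
    moreover have "\<phi> (elem_sym k) = \<psi> (elem_sym k)" using k by (intro less.prems(1))
    ultimately show ?case
      by (simp add: alg_hom_diff[OF \<phi>] alg_hom_diff[OF \<psi>] alg_homD(4)[OF \<phi>] alg_homD(4)[OF \<psi>])
  qed
  \<comment> \<open>The reduction needs \<open>k \<ge> 1\<close> for the degree to drop, so the constant term is removed first.\<close>
  define f0 where "f0 = sym_scale (sym_coeff f {#}) 1"
  have f0: "sym_coeff f0 M = (if M = {#} then sym_coeff f {#} else 0)" for M
    by (simp add: f0_def sym_scale.rep_eq one_sym.rep_eq)
  have "sym_support_ge (f - f0) 1"
    unfolding sym_support_ge_def minus_sym.rep_eq f0 by (auto simp: Suc_le_eq card_gt_0_iff)
  moreover have "sym_degree_le (f - f0) d"
    using less.prems(2) by (auto simp: sym_degree_le_def minus_sym.rep_eq f0)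
  ultimately have "\<phi> (f - f0) = \<psi> (f - f0)" by (intro step[of 1]) auto
  moreover have "\<phi> f0 = \<psi> f0"
    by (simp add: f0_def alg_homD(2,3)[OF \<phi>] alg_homD(2,3)[OF \<psi>])
  ultimately show ?case by (simp add: alg_hom_diff[OF \<phi>] alg_hom_diff[OF \<psi>])
qed

section \<open>Homomorphisms on the symmetric functions\<close>

definition bounded_msets :: "nat \<Rightarrow> nat \<Rightarrow> nat multiset set" where
  "bounded_msets N d = {M. set_mset M \<subseteq> {..<N} \<and> size M \<le> d}"

lemma finite_bounded_msets: "finite (bounded_msets N d)"
proof (rule finite_subset)
  show "bounded_msets N d \<subseteq> mset ` {xs. set xs \<subseteq> {..<N} \<and> length xs \<le> d}"
  proof
    fix M assume M: "M \<in> bounded_msets N d"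
    obtain xs where "mset xs = M" using ex_mset by blast
    with M show "M \<in> mset ` {xs. set xs \<subseteq> {..<N} \<and> length xs \<le> d}"
      by (auto simp: bounded_msets_def)
  qed
qed (simp add: finite_lists_length_le)

text \<open>
  Evaluation at the point \<open>(x 0, \<dots>, x (N - 1), 0, 0, \<dots>)\<close>.
\<close>

definition sym_eval :: "nat \<Rightarrow> (nat \<Rightarrow> complex) \<Rightarrow> sym \<Rightarrow> complex" where
  "sym_eval N x f =
    (\<Sum>M | set_mset M \<subseteq> {..<N} \<and> sym_coeff f M \<noteq> 0. sym_coeff f M * (\<Prod>i\<in>#M. x i))"

lemma sym_eval_eq:
  assumes "sym_degree_le f d"
  shows "sym_eval N x f = (\<Sum>M\<in>bounded_msets N d. sym_coeff f M * (\<Prod>i\<in>#M. x i))"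
  unfolding sym_eval_def
  using assms by (intro sum.mono_neutral_left finite_bounded_msets)
    (auto simp: bounded_msets_def sym_degree_le_def)

lemma sym_eval_mult: "sym_eval N x (f * g) = sym_eval N x f * sym_eval N x g"
proof -
  obtain d d' where f: "sym_degree_le f d" and g: "sym_degree_le g d'"
    using sym_degree_le_exists by meson
  let ?x = "\<lambda>M. \<Prod>i\<in>#M. x i"
  let ?F = "\<lambda>A B. (sym_coeff f A * ?x A) * (sym_coeff g B * ?x B)"
  have f0: "size A \<le> d" if "sym_coeff f A \<noteq> 0" for A
    using f that unfolding sym_degree_le_def by blast
  have g0: "size A \<le> d'" if "sym_coeff g A \<noteq> 0" for A
    using g that unfolding sym_degree_le_def by blast
  have "sym_eval N x (f * g) = (\<Sum>M\<in>bounded_msets N (d + d'). sym_coeff (f * g) M * ?x M)"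
    by (rule sym_eval_eq[OF sym_degree_le_mult[OF f g]])
  also have "\<dots> = (\<Sum>M\<in>bounded_msets N (d + d'). \<Sum>A | A \<subseteq># M. ?F A (M - A))"
  proof (rule sum.cong[OF refl])
    fix M
    have "?x M = ?x A * ?x (M - A)" if "A \<subseteq># M" for A
      using that by (metis image_mset_union prod_mset.union subset_mset.add_diff_inverse)
    then show "sym_coeff (f * g) M * ?x M = (\<Sum>A | A \<subseteq># M. ?F A (M - A))"
      unfolding times_sym.rep_eq conv_def sum_distrib_right
      by (intro sum.cong) (auto simp: algebra_simps)
  qed
  also have "\<dots> = (\<Sum>(M, A)\<in>(SIGMA M:bounded_msets N (d + d'). {A. A \<subseteq># M}). ?F A (M - A))"
    by (rule sum.Sigma) (auto simp: finite_bounded_msets finite_submsets)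
  also have "\<dots> = (\<Sum>(M, A)\<in>{(M, A). M \<in> bounded_msets N (d + d') \<and> A \<subseteq># M \<and>
      size A \<le> d \<and> size (M - A) \<le> d'}. ?F A (M - A))"
    using f0 g0
    by (intro sum.mono_neutral_right finite_SigmaI)
      (auto simp: finite_bounded_msets finite_submsets)
  also have "\<dots> = (\<Sum>(A, B)\<in>bounded_msets N d \<times> bounded_msets N d'. ?F A B)"
    by (rule sum.reindex_bij_witness[of _ "\<lambda>(A, B). (A + B, A)" "\<lambda>(M, A). (A, M - A)"])
      (auto simp: bounded_msets_def dest: set_mset_mono in_diffD)
  also have "\<dots> = sym_eval N x f * sym_eval N x g"
    by (simp add: sym_eval_eq[OF f] sym_eval_eq[OF g] sum_product sum.cartesian_product)
  finally show ?thesis .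
qed

lemma sym_eval_hom: "alg_hom sym_scale (*) (sym_eval N x)"
  unfolding alg_hom_iff[OF vector_space_sym vector_space_complex]
proof (intro conjI allI)
  fix f g c
  obtain d where f: "sym_degree_le f d" and g: "sym_degree_le g d"
    using sym_degree_le_exists sym_degree_le_mono by (metis nle_le)
  show "sym_eval N x (f + g) = sym_eval N x f + sym_eval N x g"
    using f g by (simp add: sym_eval_eq[of _ d] sym_degree_le_add plus_sym.rep_eq distrib_right sum.distrib)
  show "sym_eval N x (sym_scale c f) = c * sym_eval N x f"
    using f by (simp add: sym_eval_eq[of _ d] sym_degree_le_scale sym_scale.rep_eq sum_distrib_left mult.assoc)
  show "sym_eval N x (f * g) = sym_eval N x f * sym_eval N x g" by (rule sym_eval_mult)
  have "{M. set_mset M \<subseteq> {..<N} \<and> sym_coeff 1 M \<noteq> 0} = {{#}}"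
    by (auto simp: one_sym.rep_eq)
  then show "sym_eval N x 1 = 1" by (simp add: sym_eval_def one_sym.rep_eq)
qed

lemma sym_eval_elem:
  "sym_eval N x (elem_sym n) = (\<Sum>X | X \<subseteq> {..<N} \<and> card X = n. \<Prod>i\<in>X. x i)"
proof -
  have "{M. set_mset M \<subseteq> {..<N} \<and> sym_coeff (elem_sym n) M \<noteq> 0} =
      mset_set ` {X. X \<subseteq> {..<N} \<and> card X = n}" (is "?L = ?R")
  proof (intro equalityI subsetI)
    fix M assume M: "M \<in> ?L"
    then have sq: "\<forall>i. count M i \<le> 1" "size M = n" by (auto simp: elem_sym.rep_eq split: if_splits)
    have eq: "mset_set (set_mset M) = M" by (rule squarefree_eq_mset_set[OF sq(1)])
    then have "card (set_mset M) = n" using sq(2) by (metis size_mset_set)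
    then show "M \<in> ?R" using M eq by (intro image_eqI[of _ _ "set_mset M"]) auto
  next
    fix M assume "M \<in> ?R"
    then obtain X where X: "M = mset_set X" "X \<subseteq> {..<N}" "card X = n" by blast
    then have "finite X" using finite_subset by blast
    then show "M \<in> ?L" using X by (auto simp: elem_sym.rep_eq count_mset_set')
  qed
  moreover have "inj_on mset_set {X. X \<subseteq> {..<N} \<and> card X = n}"
    by (rule inj_on_subset[OF inj_on_mset_set[of "{..<N}"]]) auto
  ultimately have "sym_eval N x (elem_sym n) = (\<Sum>X | X \<subseteq> {..<N} \<and> card X = n.
      sym_coeff (elem_sym n) (mset_set X) * (\<Prod>i\<in>#mset_set X. x i))"
    unfolding sym_eval_def by (simp add: sum.reindex)
  also have "\<dots> = (\<Sum>X | X \<subseteq> {..<N} \<and> card X = n. \<Prod>i\<in>X. x i)"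
    by (intro sum.cong) (auto simp: elem_sym.rep_eq count_mset_set' prod_unfold_prod_mset)
  finally show ?thesis .
qed

lemma coeff_prod_linear:
  fixes x :: "nat \<Rightarrow> complex"
  assumes "n \<le> N"
  shows "coeff (\<Prod>i<N. [:x i, 1:]) (N - n) = (\<Sum>X | X \<subseteq> {..<N} \<and> card X = n. \<Prod>i\<in>X. x i)"
proof -
  have "(\<Prod>i<N. [:x i, 1:]) = (\<Prod>i<N. [:x i:] + monom 1 1)"
    by (simp add: monom_Suc monom_0)
  also have "\<dots> = (\<Sum>X\<in>Pow {..<N}. (\<Prod>i\<in>X. [:x i:]) * (\<Prod>i\<in>{..<N} - X. monom 1 1))"
    by (rule prod_add) simp
  also have "\<dots> = (\<Sum>X\<in>Pow {..<N}. monom (\<Prod>i\<in>X. x i) (N - card X))"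
  proof (rule sum.cong)
    fix X assume X: "X \<in> Pow {..<N}"
    then have "finite X" using finite_subset by blast
    have "(\<Prod>i\<in>X. [:x i:]) = [:\<Prod>i\<in>X. x i:]"
      by (induction X rule: infinite_finite_induct) (simp_all add: one_pCons)
    moreover have "card ({..<N} - X) = N - card X"
      using X by (simp add: card_Diff_subset \<open>finite X\<close>)
    ultimately show "(\<Prod>i\<in>X. [:x i:]) * (\<Prod>i\<in>{..<N} - X. monom 1 1) = monom (\<Prod>i\<in>X. x i) (N - card X)"
      by (simp add: monom_power smult_monom)
  qed simp
  also have "coeff \<dots> (N - n) = (\<Sum>X\<in>Pow {..<N}. if card X = n then \<Prod>i\<in>X. x i else 0)"
    unfolding coeff_sum
  proof (rule sum.cong)
    fix X assume "X \<in> Pow {..<N}"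
    then have "card X \<le> N" using card_mono[of "{..<N}" X] by simp
    then have "N - card X = N - n \<longleftrightarrow> card X = n" using assms by linarith
    then show "coeff (monom (\<Prod>i\<in>X. x i) (N - card X)) (N - n) = (if card X = n then \<Prod>i\<in>X. x i else 0)"
      by simp
  qed simp
  also have "\<dots> = (\<Sum>X | X \<subseteq> {..<N} \<and> card X = n. \<Prod>i\<in>X. x i)"
    by (subst sum.inter_filter[symmetric]) (auto intro!: sum.cong)
  finally show ?thesis .
qed

text \<open>
  The complex numbers are algebraically closed: the polynomial
  \<open>z\<^sup>N + t 1 z\<^bsup>N - 1\<^esup> + \<dots> + t N\<close> splits into linear factors \<open>z + x i\<close>, and by Vieta's formulas the
  elementary symmetric functions of the \<open>x i\<close> are its coefficients.
\<close>

lemma sym_eval_interpolation: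
  fixes t :: "nat \<Rightarrow> complex"
  assumes "t 0 = 1"
  shows "\<exists>x. \<forall>n\<le>N. sym_eval N x (elem_sym n) = t n"
proof -
  define p where "p = (\<Sum>i\<le>N. monom (t (N - i)) i)"
  have coeff_p: "coeff p i = (if i \<le> N then t (N - i) else 0)" for i
    by (simp add: p_def coeff_sum)
  have deg: "degree p = N"
    using assms by (intro antisym degree_le le_degree) (auto simp: coeff_p)
  have lead: "lead_coeff p = 1" using assms by (simp add: deg coeff_p)
  then obtain A where A: "size A = N" "p = (\<Prod>a\<in>#A. [:-a, 1:])"
    using alg_closed_imp_factorization[of p] deg by (metis leading_coeff_0_iff smult_1_left zero_neq_one)
  obtain xs where xs: "mset xs = A" using ex_mset by blast
  define x where "x i = - (xs ! i)" for i
  have "p = prod_list (map (\<lambda>a. [:-a, 1:]) xs)"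
    unfolding A(2) xs[symmetric] by (metis mset_map prod_mset_prod_list)
  also have "\<dots> = (\<Prod>i<length xs. [:x i, 1:])"
    by (simp add: prod.list_conv_set_nth x_def atLeast0LessThan)
  also have "length xs = N" using A(1) xs by (metis size_mset)
  finally have p: "p = (\<Prod>i<N. [:x i, 1:])" .
  have "sym_eval N x (elem_sym n) = t n" if "n \<le> N" for n
    using coeff_prod_linear[OF that, of x] that by (simp add: sym_eval_elem p[symmetric] coeff_p)
  then show ?thesis by blast
qed

text \<open>
  For elementary symmetric functions of bounded degree, an evaluation at a suitable point has the
  prescribed values. The evaluations for different bounds agree wherever both bounds apply, because
  a homomorphism is determined by its values at the elementary symmetric functions, and so they fit
  together.
\<close>

theorem sym_hom_with_elem_values:
  fixes t :: "nat \<Rightarrow> complex"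
  assumes "t 0 = 1"
  shows "\<exists>\<theta>. alg_hom sym_scale (*) \<theta> \<and> (\<forall>n. \<theta> (elem_sym n) = t n)"
proof -
  obtain x where x: "\<And>N n. n \<le> N \<Longrightarrow> sym_eval N (x N) (elem_sym n) = t n"
    using sym_eval_interpolation[of t] assms by metis
  define ev where "ev N = sym_eval N (x N)" for N
  define \<theta> where "\<theta> f = ev (LEAST d. sym_degree_le f d) f" for f
  have hom: "alg_hom sym_scale (*) (ev N)" for N unfolding ev_def by (rule sym_eval_hom)
  have \<theta>_eq: "\<theta> f = ev N f" if "sym_degree_le f N" for f N
    unfolding \<theta>_def
  proof (rule sym_hom_eq_of_elem[OF hom hom])
    let ?d = "LEAST d. sym_degree_le f d"
    show "sym_degree_le f ?d" using that by (rule LeastI)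
    have "?d \<le> N" using that by (rule Least_le)
    then show "ev ?d (elem_sym n) = ev N (elem_sym n)" if "n \<le> ?d" for n
      using that by (simp add: ev_def x)
  qed
  have "alg_hom sym_scale (*) \<theta>"
    unfolding alg_hom_iff[OF vector_space_sym vector_space_complex]
  proof (intro conjI allI)
    fix f g c
    obtain d where f: "sym_degree_le f d" and g: "sym_degree_le g d"
      using sym_degree_le_exists sym_degree_le_mono by (metis nle_le)
    show "\<theta> (f + g) = \<theta> f + \<theta> g"
      using f g by (simp add: \<theta>_eq[of _ d] sym_degree_le_add alg_homD[OF hom])
    show "\<theta> (sym_scale c f) = c * \<theta> f"
      using f by (simp add: \<theta>_eq[of _ d] sym_degree_le_scale alg_homD[OF hom])
    have "sym_degree_le f (d + d)" "sym_degree_le g (d + d)"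
      using f g sym_degree_le_mono by auto
    then show "\<theta> (f * g) = \<theta> f * \<theta> g"
      using sym_degree_le_mult[OF f g] by (simp add: \<theta>_eq[of _ "d + d"] alg_homD[OF hom])
    have "sym_degree_le 1 0" by (simp add: sym_degree_le_def one_sym.rep_eq)
    then show "\<theta> 1 = 1" by (simp add: \<theta>_eq alg_homD[OF hom])
  qed
  moreover have "\<theta> (elem_sym n) = t n" for n
    using \<theta>_eq[OF sym_degree_le_elem] x[of n n] by (simp add: ev_def)
  ultimately show ?thesis by blast
qed

lemma elem_sym_0: "elem_sym 0 = 1"
  by (rule sym_eqI) (auto simp: elem_sym.rep_eq one_sym.rep_eq)

lemma complete_sym_0: "complete_sym 0 = 1"
  by (rule sym_eqI) (auto simp: complete_sym.rep_eq one_sym.rep_eq)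

text \<open>
  A homomorphism turns the relation between elementary and complete functions into
  \<open>E(z) H(-z) = 1\<close> for the generating functions of its values, so prescribing one of the two
  series prescribes the other.
\<close>

lemma hom_complete_iff_hom_elem:
  assumes \<theta>: "alg_hom sym_scale (*) \<theta>" and S: "S $ 0 = 1"
  shows "(\<forall>n\<ge>1. \<theta> (complete_sym n) = (- 1) ^ n * S $ n) \<longleftrightarrow>
    (\<forall>n. \<theta> (elem_sym n) = inverse S $ n)"
proof -
  define E where "E = Abs_fps (\<lambda>n. \<theta> (elem_sym n))"
  define H where "H = Abs_fps (\<lambda>n. (-1) ^ n * \<theta> (complete_sym n))"
  have sign: "\<theta> ((-1) ^ i * f) = (-1) ^ i * \<theta> f" for i f
    using alg_hom_diff[OF \<theta>, of 0 f] by (cases "even i") (simp_all add: alg_hom_zero[OF \<theta>])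
  have "E * H = 1"
  proof (rule fps_ext)
    fix n
    show "(E * H) $ n = 1 $ n"
    proof (cases "n = 0")
      case True
      then show ?thesis by (simp add: E_def H_def elem_sym_0 complete_sym_0 alg_homD(3)[OF \<theta>])
    next
      case False
      have "(E * H) $ n = (\<Sum>i\<le>n. (-1) ^ (n - i) * (\<theta> (elem_sym i) * \<theta> (complete_sym (n - i))))"
        by (simp add: fps_mult_nth E_def H_def atLeast0AtMost algebra_simps)
      also have "\<dots> = (\<Sum>i\<le>n. (-1) ^ n * ((-1) ^ i * (\<theta> (elem_sym i) * \<theta> (complete_sym (n - i)))))"
        by (intro sum.cong) (auto simp: minus_one_power_iff)
      also have "\<dots> = (-1) ^ n * \<theta> (\<Sum>i\<le>n. (-1) ^ i * (elem_sym i * complete_sym (n - i)))"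
        by (simp only: alg_hom_sum[OF \<theta>] sign sum_distrib_left) (simp add: alg_homD(4)[OF \<theta>])
      also have "\<dots> = 0" using False by (simp add: elem_complete_relation alg_hom_zero[OF \<theta>])
      finally show ?thesis using False by simp
    qed
  qed
  have "(\<forall>n\<ge>1. \<theta> (complete_sym n) = (- 1) ^ n * S $ n) \<longleftrightarrow> H = S"
  proof
    assume *: "\<forall>n\<ge>1. \<theta> (complete_sym n) = (- 1) ^ n * S $ n"
    show "H = S"
    proof (rule fps_ext)
      fix n
      show "H $ n = S $ n"
        using * S by (cases "n = 0") (simp_all add: H_def complete_sym_0 alg_homD(3)[OF \<theta>] flip: mult.assoc power_mult_distrib)
    qed
  next
    assume "H = S"
    then have "S $ n = (-1) ^ n * \<theta> (complete_sym n)" for n by (auto simp: H_def)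
    then show "\<forall>n\<ge>1. \<theta> (complete_sym n) = (- 1) ^ n * S $ n"
      by (simp flip: mult.assoc power_mult_distrib)
  qed
  also have "\<dots> \<longleftrightarrow> E = inverse S"
    using \<open>E * H = 1\<close> S by (metis fps_inverse_unique inverse_mult_eq_1 mult.commute mult_1 mult.assoc zero_neq_one)
  also have "\<dots> \<longleftrightarrow> (\<forall>n. \<theta> (elem_sym n) = inverse S $ n)" by (simp add: E_def fps_eq_iff)
  finally show ?thesis .
qed

theorem sym_universal_complete:
  assumes S: "S $ 0 = 1"
  shows "\<exists>!\<theta>. alg_hom sym_scale (*) \<theta> \<and> (\<forall>n\<ge>1. \<theta> (complete_sym n) = (- 1) ^ n * S $ n)"
proof -
  obtain \<theta> where \<theta>: "alg_hom sym_scale (*) \<theta>" "\<forall>n. \<theta> (elem_sym n) = inverse S $ n"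
    using sym_hom_with_elem_values[of "fps_nth (inverse S)"] S by auto
  show ?thesis
  proof (rule ex1I[of _ \<theta>])
    show "alg_hom sym_scale (*) \<theta> \<and> (\<forall>n\<ge>1. \<theta> (complete_sym n) = (- 1) ^ n * S $ n)"
      using \<theta> hom_complete_iff_hom_elem[OF \<theta>(1) S] by blast
  next
    fix \<phi>
    assume \<phi>: "alg_hom sym_scale (*) \<phi> \<and> (\<forall>n\<ge>1. \<phi> (complete_sym n) = (- 1) ^ n * S $ n)"
    then have "\<forall>n. \<phi> (elem_sym n) = inverse S $ n" using hom_complete_iff_hom_elem S by blast
    then show "\<phi> = \<theta>"
      using sym_hom_eq_of_elem[of \<phi> \<theta>] \<phi> \<theta> sym_degree_le_exists by (metis ext)
  qed
qed

section \<open>The character of the R-transform\<close>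

text \<open>
  The partition sum defining \<open>y_sym n\<close> becomes the moment of order \<open>n - 1\<close> whose cumulants are the
  values at the elementary symmetric functions.
\<close>

lemma hom_y_sym:
  assumes "alg_hom sym_scale (*) \<theta>"
  shows "\<theta> (y_sym n) = nc_moments (\<lambda>k. \<theta> (elem_sym k)) $ (n - 1)"
  by (simp add: y_sym_def nc_moments_def alg_hom_sum[OF assms] alg_hom_prod[OF assms])

theorem proposition6p9:
  fixes \<mu> :: "complex poly \<Rightarrow> complex"
  assumes "\<mu> \<in> G1"
  shows "(\<exists>!\<chi>. is_chi \<mu> \<chi>) \<and> (\<exists>!\<theta>. is_theta \<mu> \<theta>) \<and> (\<exists>!\<Phi>. is_Phi \<Phi>) \<and>
         chi \<mu> = theta \<mu> \<circ> Phi"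
proof -
  have S: "S_transform \<mu> $ 0 = 1" by (rule S_transform_props(2)[OF assms])
  have ex_chi: "\<exists>!\<chi>. is_chi \<mu> \<chi>"
    unfolding is_chi_def by (rule Y1_universal[OF vector_space_complex]) (simp add: mult.assoc)
  have ex_theta: "\<exists>!\<theta>. is_theta \<mu> \<theta>"
    unfolding is_theta_def by (rule sym_universal_complete[OF S])
  have ex_Phi: "\<exists>!\<Phi>. is_Phi \<Phi>"
    unfolding is_Phi_def by (rule Y1_universal[OF vector_space_sym]) (rule sym_scale_mult)
  have theta: "is_theta \<mu> (theta \<mu>)" unfolding theta_def by (rule theI'[OF ex_theta])
  have Phi: "is_Phi Phi" unfolding Phi_def by (rule theI'[OF ex_Phi])
  have hom: "alg_hom sym_scale (*) (theta \<mu>)" using theta by (simp add: is_theta_def)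
  have elem: "(\<lambda>k. theta \<mu> (elem_sym k)) = fps_nth (inverse (S_transform \<mu>))"
    using theta hom_complete_iff_hom_elem[OF hom S] by (auto simp: is_theta_def)
  have "theta \<mu> (y_sym n) = R_transform \<mu> $ n" if "n \<ge> 2" for n
    using R_transform_nth[OF assms, of "n - 1"] that by (simp add: hom_y_sym[OF hom] elem)
  then have "is_chi \<mu> (theta \<mu> \<circ> Phi)"
    using Phi alg_hom_comp[of Y1_scale sym_scale Phi "(*)" "theta \<mu>"] hom
    by (simp add: is_chi_def is_Phi_def)
  then have "chi \<mu> = theta \<mu> \<circ> Phi"
    unfolding chi_def by (rule the1_equality[OF ex_chi])
  with ex_chi ex_theta ex_Phi show ?thesis by blast
qed

end
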